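(* Let $\alpha>2$, $\beta>2$, $\nu>1$, $\theta>0$, $\sigma^2>0$, $0<\epsilon<1$, $0<\delta<1$, $z_m,z_s>0$ and an integer $K\ge0$ be fixed. Let $\mu>0$ be such that $$\Pr\left(\sum_{Y\in \Phi(1)} \left[|U_Y|^{-\alpha}\, 1\{Y \notin \{Y_0\}\cup\mathcal{C}\}-\theta^{-1} |U_0|^{-\alpha}\,1\{Y = Y_0\}\right]+ \mu > 0\right)=\epsilon ,$$ where $\Phi(1)$ is the base-station process of density $1$. Consider the hybrid network described in the context, with mobiles having small energy storage, and let $\mathcal{F}_h$ be its feasibility region, i.e. the set of triples $(q,\lambda_b,\lambda_p)$ (power-beacon transmission power, base-station density, power-beacon density) for which there is a mobile-transmission power $p>0$ satisfying the outage constraint $P_{\mathsf{out}}(\lambda_b,p)\le\epsilon$ and the power-outage constraint $\Pr(P<p)\le\delta$. Then: 1. for isotropic microwave power transfer, $$\left\{(q,\lambda_b, \lambda_p)\in \mathbb{R}_+^3 \;\middle|\; q^{2/\beta}\lambda_p\lambda_b^{\alpha/\beta} \geq \frac{\log\frac{1}{\delta}}{\pi}\left(\frac{\sigma^2}{\mu }\right)^{2/\beta},\ q^{2/\alpha}\lambda_b \geq \left(\frac{\sigma^2\nu^\beta}{\mu }\right)^{2/\alpha}\right\}\subset \mathcal{F}_h;$$ 2. for directed microwave power transfer, $$\left\{(q,\lambda_b, \lambda_p)\in \mathbb{R}_+^3 \;\middle|\; (z_m q)^{2/\beta}\lambda_p\lambda_b^{\alpha/\beta} \geq \frac{\log\frac{1}{\delta}}{\pi}\left(\frac{\sigma^2}{\mu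 }\right)^{2/\beta},\ (z_mq)^{2/\alpha}\lambda_b \geq \left(\frac{\sigma^2\nu^\beta}{\mu }\right)^{2/\alpha}\right\}\subset\mathcal{F}_h.$$
   Context: $\mathbb{R}_+$ is the set of nonnegative reals. Cellular (uplink) network: base stations form a homogeneous Poisson point process on $\mathbb{R}^2$ with density $\lambda_b$. Considered from a typical base station $Y_0$ at the origin (Palm version), the process $\Phi=\Phi(\lambda_b)$ consists of the point $Y_0=0$ together with a homogeneous Poisson point process of density $\lambda_b$. Each base station $Y\in\Phi$ serves exactly one active mobile $U_Y$; given $\Phi$, the mobiles $U_Y$ are independent and $U_Y$ is uniform in the Voronoi cell of $Y$. Write $U_0=U_{Y_0}$. Let $\mathcal{C}\subset\Phi\setminus\{Y_0\}$ be the set of the $K$ base stations whose active mobiles are the $K$ interfering mobiles ($U_Y$ with $Y\ne Y_0$) nearest to $Y_0$; their interference at $Y_0$ is perfectly canceled. All mobiles transmit with power $p$; with noise variance $\sigma^2$ and interference $I=\sum_{Y\in\Phi\setminus(\{Y_0\}\cup\mathcal{C})}p|U_Y|^{-\alpha}$, the outage probability is $$P_{\mathsf{out}}(\lambda_b,p)=\Pr\left(\frac{p|U_0|^{-\alpha}}{I+\sigma^2}<\theta\right).$$ Power-beacon network: power beacons form a homogeneous Poisson point process $\Psi$ on $\mathbb{R}^2$ with density $\lambda_p$, independent of base stations and mobiles. The raw power $P$ received by the mobile $U_0$ is - for isotropic microwave power transfer: $P=q\sum_{T\in\Psi}[\max(|T-U_0|,\nu)]^{-\beta}$; - for directed microwave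 power transfer: $P=z_m q\max(|U_0-T_0|,\nu)^{-\beta}+z_s q\sum_{T\in\Psi\setminus\{T_0\}}\max(|U_0-T|,\nu)^{-\beta}$, where $T_0$ is the point of $\Psi$ nearest to $U_0$ and $z_m,z_s$ are the main-lobe and side-lobe responses. Small energy storage: the received raw power at a mobile is required to be below a threshold (power outage) with probability at most $\delta$; the threshold is the transmission power $p$ of the mobile. *)

theory Defs
  imports "HOL-Probability.Probability"
begin

type_synonym plane = "real ^ 2"

definition point_configs :: "plane set measure" where
  "point_configs =
     (let \<Omega> = {S. \<forall>B. bounded B \<longrightarrow> finite (S \<inter> B)} in
      sigma \<Omega> {{S \<in> \<Omega>. card (S \<inter> B) = k} | B k. bounded B \<and> B \<in> sets borel})"

text \<open>
  The Poisson probabilities are written out because the library's \<open>poisson_pmf\<close> is only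
  meaningful for a positive rate, whereas here \<open>B\<close> may be a null set.
\<close>

definition poisson_process :: "'w measure \<Rightarrow> real \<Rightarrow> ('w \<Rightarrow> plane set) \<Rightarrow> bool" where
  "poisson_process M \<rho> X \<longleftrightarrow>
     X \<in> measurable M point_configs \<and>
     (\<forall>B k. bounded B \<and> B \<in> sets borel \<longrightarrow>
        measure M {\<omega> \<in> space M. card (X \<omega> \<inter> B) = k} =
          exp (- (\<rho> * measure lborel B)) * (\<rho> * measure lborel B) ^ k / fact k) \<and>
     (\<forall>B :: nat \<Rightarrow> plane set.
        (\<forall>i. bounded (B i) \<and> B i \<in> sets borel) \<and> disjoint_family B \<longrightarrow>
        prob_space.indep_vars M (\<lambda>_. count_space UNIV) (\<lambda>i \<omega>. card (X \<omega> \<inter> B i)) UNIV)"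

definition voronoi_cell :: "plane set \<Rightarrow> plane \<Rightarrow> plane set" where
  "voronoi_cell S y = {u. \<forall>x\<in>S. dist u y \<le> dist u x}"

definition stations :: "(nat \<Rightarrow> 'w \<Rightarrow> plane) \<Rightarrow> 'w \<Rightarrow> plane set" where
  "stations Y \<omega> = range (\<lambda>n. Y n \<omega>)"

text \<open>
  The base stations are labelled by their distance to the origin: \<open>Y 0\<close> is the typical
  station and \<open>Y 1\<close>, \<open>Y 2\<close>, ... are the points of the Poisson process
  (almost surely infinite in number and without ties, as \<open>\<rho> > 0\<close>).  The mobile served
  by \<open>Y n\<close> is \<open>U n\<close>.  The last clause states that, given the \<open>\<sigma>\<close>-algebra generated by the
  set of base stations, the mobiles are independent and \<open>U n\<close> is uniform in the Voronoi
  cell of \<open>Y n\<close>.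
\<close>

definition uplink_network ::
    "'w measure \<Rightarrow> real \<Rightarrow> (nat \<Rightarrow> 'w \<Rightarrow> plane) \<Rightarrow> (nat \<Rightarrow> 'w \<Rightarrow> plane) \<Rightarrow> bool" where
  "uplink_network M \<rho> Y U \<longleftrightarrow>
     (\<forall>n. Y n \<in> borel_measurable M) \<and> (\<forall>n. U n \<in> borel_measurable M) \<and>
     (\<forall>\<omega>\<in>space M. Y 0 \<omega> = 0) \<and>
     (AE \<omega> in M. strict_mono (\<lambda>n. norm (Y n \<omega>))) \<and>
     poisson_process M \<rho> (\<lambda>\<omega>. (\<lambda>n. Y n \<omega>) ` {1..}) \<and>
     (\<forall>n B. (\<forall>i. B i \<in> sets borel) \<longrightarrow>
        (AE \<omega> in M.
           real_cond_exp M (vimage_algebra (space M) (stations Y) point_configs)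
             (indicator {\<omega> \<in> space M. \<forall>i\<le>n. U i \<omega> \<in> B i}) \<omega> =
           (\<Prod>i\<le>n. measure (uniform_measure lborel (voronoi_cell (stations Y \<omega>) (Y i \<omega>))) (B i))))"

text \<open>
  Labels of the stations whose mobiles are the \<open>K\<close> interfering mobiles nearest to the origin.
  The finiteness condition is needed because infinite sets have \<open>card\<close> 0.
\<close>

definition cancelled :: "nat \<Rightarrow> (nat \<Rightarrow> plane) \<Rightarrow> nat set" where
  "cancelled K u =
     {n. n \<noteq> 0 \<and> finite {m. m \<noteq> 0 \<and> norm (u m) < norm (u n)} \<and>
         card {m. m \<noteq> 0 \<and> norm (u m) < norm (u n)} < K}"

text \<open>
  Sums of nonnegative powers are taken in \<open>[0, \<infinity>]\<close>, so that no convergence convention enters;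
  in particular the signal-to-interference-plus-noise ratio is 0 if the interference is infinite.
\<close>

definition interference :: "real \<Rightarrow> nat \<Rightarrow> real \<Rightarrow> (nat \<Rightarrow> plane) \<Rightarrow> ennreal" where
  "interference \<alpha> K p u =
     (\<Sum>\<^sub>\<infinity>n \<in> - ({0} \<union> cancelled K u). ennreal (p * norm (u n) powr (- \<alpha>)))"

definition outage_prob ::
    "'w measure \<Rightarrow> real \<Rightarrow> real \<Rightarrow> real \<Rightarrow> nat \<Rightarrow> (nat \<Rightarrow> 'w \<Rightarrow> plane) \<Rightarrow> real \<Rightarrow> real" where
  "outage_prob M \<alpha> \<theta> \<sigma> K U p =
     measure M {\<omega> \<in> space M.
       ennreal (p * norm (U 0 \<omega>) powr (- \<alpha>)) /
         (interference \<alpha> K p (\<lambda>n. U n \<omega>) + ennreal (\<sigma>\<^sup>2)) < ennreal \<theta>}"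

text \<open>
  If the sum fails to converge (a null event for \<open>\<alpha> > 2\<close>), its value is 0 by convention, and
  \<open>normalized_excess \<alpha> \<theta> K u + \<mu> > 0\<close> holds for every \<open>\<mu> > 0\<close>, just as it would for the value \<open>\<infinity>\<close>.
\<close>

definition normalized_excess :: "real \<Rightarrow> real \<Rightarrow> nat \<Rightarrow> (nat \<Rightarrow> plane) \<Rightarrow> real" where
  "normalized_excess \<alpha> \<theta> K u =
     (\<Sum>\<^sub>\<infinity>n. norm (u n) powr (- \<alpha>) * of_bool (n \<notin> {0} \<union> cancelled K u)
           - inverse \<theta> * norm (u 0) powr (- \<alpha>) * of_bool (n = 0))"

definition isotropic_power ::
    "real \<Rightarrow> real \<Rightarrow> real \<Rightarrow> plane set \<Rightarrow> plane \<Rightarrow> ennreal" where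
  "isotropic_power \<beta> \<nu> q S u =
     ennreal q * (\<Sum>\<^sub>\<infinity>T\<in>S. ennreal (max (dist T u) \<nu> powr (- \<beta>)))"

definition directed_power ::
    "real \<Rightarrow> real \<Rightarrow> real \<Rightarrow> real \<Rightarrow> real \<Rightarrow> plane set \<Rightarrow> plane \<Rightarrow> ennreal" where
  "directed_power \<beta> \<nu> z\<^sub>m z\<^sub>s q S u =
     (let T\<^sub>0 = arg_min (\<lambda>T. dist T u) (\<lambda>T. T \<in> S) in
      ennreal (z\<^sub>m * q * max (dist u T\<^sub>0) \<nu> powr (- \<beta>)) +
      ennreal (z\<^sub>s * q) * (\<Sum>\<^sub>\<infinity>T\<in>S - {T\<^sub>0}. ennreal (max (dist u T) \<nu> powr (- \<beta>))))"

text \<open>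
  \<open>pow q S u\<close> is the power received at \<open>u\<close> from beacons of power \<open>q\<close> located at the points of \<open>S\<close>;
  \<open>U\<^sub>0\<close> is the location of the typical mobile and \<open>p\<close> the required power.
\<close>

definition power_outage_prob ::
    "'w measure \<Rightarrow> (real \<Rightarrow> plane set \<Rightarrow> plane \<Rightarrow> ennreal) \<Rightarrow> real \<Rightarrow>
     ('w \<Rightarrow> plane set) \<Rightarrow> ('w \<Rightarrow> plane) \<Rightarrow> real \<Rightarrow> real" where
  "power_outage_prob M pow q \<Psi> U\<^sub>0 p =
     measure M {\<omega> \<in> space M. pow q (\<Psi> \<omega>) (U\<^sub>0 \<omega>) < ennreal p}"

text \<open>
  \<open>Y \<rho>\<close>, \<open>U \<rho>\<close> are the stations and mobiles at base-station density \<open>\<rho>\<close>, and \<open>\<Psi> \<rho>\<close> are the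
  beacons at beacon density \<open>\<rho>\<close>.  All are placed on one probability space, but nothing is assumed
  about the joint law of networks of different base-station (or beacon) densities.
\<close>

definition hybrid_network ::
    "'w measure \<Rightarrow> (real \<Rightarrow> nat \<Rightarrow> 'w \<Rightarrow> plane) \<Rightarrow> (real \<Rightarrow> nat \<Rightarrow> 'w \<Rightarrow> plane) \<Rightarrow>
     (real \<Rightarrow> 'w \<Rightarrow> plane set) \<Rightarrow> bool" where
  "hybrid_network M Y U \<Psi> \<longleftrightarrow>
     prob_space M \<and>
     (\<forall>\<rho>>0. uplink_network M \<rho> (Y \<rho>) (U \<rho>)) \<and>
     (\<forall>\<rho>>0. poisson_process M \<rho> (\<Psi> \<rho>)) \<and>
     (\<forall>\<rho>\<^sub>b>0. \<forall>\<rho>\<^sub>p>0. prob_space.indep_set M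
        (sets (vimage_algebra (space M) (\<Psi> \<rho>\<^sub>p) point_configs))
        (sets (vimage_algebra (space M) (\<lambda>\<omega> n. (Y \<rho>\<^sub>b n \<omega>, U \<rho>\<^sub>b n \<omega>))
           (Pi\<^sub>M UNIV (\<lambda>_. borel \<Otimes>\<^sub>M borel)))))"

text \<open>
  Triples \<open>(q, \<rho>\<^sub>b, \<rho>\<^sub>p)\<close>.  The densities are required to be positive since the mobiles
  (uniform in a Voronoi cell) and the nearest beacon only make sense then.
\<close>

definition feasibility_region ::
    "'w measure \<Rightarrow> (real \<Rightarrow> nat \<Rightarrow> 'w \<Rightarrow> plane) \<Rightarrow> (real \<Rightarrow> 'w \<Rightarrow> plane set) \<Rightarrow>
     (real \<Rightarrow> plane set \<Rightarrow> plane \<Rightarrow> ennreal) \<Rightarrow>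
     real \<Rightarrow> real \<Rightarrow> real \<Rightarrow> nat \<Rightarrow> real \<Rightarrow> real \<Rightarrow> (real \<times> real \<times> real) set" where
  "feasibility_region M U \<Psi> pow \<alpha> \<theta> \<sigma> K \<epsilon> \<delta> =
     {(q, \<rho>\<^sub>b, \<rho>\<^sub>p). 0 \<le> q \<and> 0 < \<rho>\<^sub>b \<and> 0 < \<rho>\<^sub>p \<and>
        (\<exists>p>0. outage_prob M \<alpha> \<theta> \<sigma> K (U \<rho>\<^sub>b) p \<le> \<epsilon> \<and>
                power_outage_prob M pow q (\<Psi> \<rho>\<^sub>p) (U \<rho>\<^sub>b 0) p \<le> \<delta>)}"

end

theory Submission
  imports Defs
begin

text \<open>
  Take \<open>p = \<sigma>\<^sup>2 / (\<mu> \<rho>\<^sub>b powr (\<alpha> / 2))\<close>. Scaling the plane by \<open>sqrt \<rho>\<^sub>b\<close> turns a network of density \<open>\<rho>\<^sub>b\<close>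
  into one of density 1 and the outage event at power \<open>p\<close> into the event defining \<open>\<mu>\<close>, so the outage
  probability is exactly \<open>\<epsilon>\<close>. This uses that the law of the mobiles is determined by the density:
  the counts in finitely many bounded sets determine the law of a Poisson process, the law of the
  process determines that of its points ordered by norm, and given these the mobiles have a
  prescribed conditional law. The power received from the nearest beacon alone is below \<open>p\<close> only if
  a disc of a certain radius around the mobile contains no beacon, which has probability at most \<open>\<delta>\<close>.
\<close>

section \<open>Point configurations and Poisson processes\<close>

text \<open>Networks of different densities share one probability space without any assumption on
  their joint law, so scaling cannot be compared outcome by outcome: every comparison is an equality
  of push-forward laws, on configurations or on sequences of points. A second obstacle is that
  counts are known to be independent only for disjoint sets, whereas an intersection-stable
  generator of \<open>point_configs\<close> involves overlapping ones; splitting these into atoms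
  closes the gap. The power \<open>p\<close> is forced by scaling. Dividing the outage inequality by
  \<open>p\<close> leaves the noise term \<open>\<sigma>\<^sup>2 / p\<close>; scaling the plane by
  \<open>sqrt \<rho>\<^sub>b\<close> multiplies every path loss by
  \<open>\<rho>\<^sub>b powr (- \<alpha> / 2)\<close>, and the noise term multiplied by the same
  factor has to equal \<open>\<mu>\<close>.\<close>

lemma space_point_configs: "space point_configs = {S. \<forall>B. bounded B \<longrightarrow> finite (S \<inter> B)}"
  by (simp add: point_configs_def Let_def space_measure_of_conv)

lemma sets_point_configs:
  "sets point_configs = sigma_sets (space point_configs)
     {{S \<in> space point_configs. card (S \<inter> B) = k} | B k. bounded B \<and> B \<in> sets borel}"
  unfolding space_point_configs by (simp add: point_configs_def Let_def) (subst sets_measure_of; auto)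

lemma finite_config_Int: "S \<in> space point_configs \<Longrightarrow> bounded B \<Longrightarrow> finite (S \<inter> B)"
  by (simp add: space_point_configs)

lemma count_sets_point_configs:
  "bounded B \<Longrightarrow> B \<in> sets borel \<Longrightarrow> {S \<in> space point_configs. card (S \<inter> B) = k} \<in> sets point_configs"
  unfolding sets_point_configs by (intro sigma_sets.Basic) auto

lemma measurable_count:
  assumes "bounded B" "B \<in> sets borel"
  shows "(\<lambda>S. card (S \<inter> B)) \<in> measurable point_configs (count_space UNIV)"
proof -
  have "(\<lambda>S. card (S \<inter> B)) -` {k} \<inter> space point_configs = {S \<in> space point_configs. card (S \<inter> B) = k}" for k
    by auto
  then show ?thesis
    by (auto simp: measurable_count_space_eq2_countable count_sets_point_configs[OF assms])
qed

lemma measurable_point_configsI: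
  assumes "\<And>\<omega>. \<omega> \<in> space M \<Longrightarrow> f \<omega> \<in> space point_configs"
    and "\<And>B k. bounded B \<Longrightarrow> B \<in> sets borel \<Longrightarrow> {\<omega> \<in> space M. card (f \<omega> \<inter> B) = k} \<in> sets M"
  shows "f \<in> measurable M point_configs"
proof (rule measurable_sigma_sets[OF sets_point_configs])
  show "f -` A \<inter> space M \<in> sets M"
    if A: "A \<in> {{S \<in> space point_configs. card (S \<inter> B) = k} | B k. bounded B \<and> B \<in> sets borel}" for A
  proof -
    obtain B k where "A = {S \<in> space point_configs. card (S \<inter> B) = k}" "bounded B" "B \<in> sets borel"
      using A by auto
    moreover from this have "f -` A \<inter> space M = {\<omega> \<in> space M. card (f \<omega> \<inter> B) = k}"
      using assms(1) by auto
    ultimately show ?thesis using assms(2) by auto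
  qed
qed (use assms(1) in auto)

section \<open>Uniqueness in law of the Poisson process of given density\<close>

lemma poisson_process_count_distr:
  assumes M: "prob_space M" and N: "prob_space N"
    and X: "poisson_process M \<rho> X" and X': "poisson_process N \<rho> X'"
    and B: "bounded B" "B \<in> sets borel"
  shows "distr M (count_space UNIV) (\<lambda>\<omega>. card (X \<omega> \<inter> B)) = distr N (count_space UNIV) (\<lambda>\<omega>. card (X' \<omega> \<inter> B))"
proof (rule measure_eqI_countable[where A=UNIV])
  interpret M: prob_space M by fact
  interpret N: prob_space N by fact
  have [measurable]: "X \<in> measurable M point_configs" "X' \<in> measurable N point_configs"
    using X X' by (auto simp: poisson_process_def)
  note [measurable] = measurable_count[OF B]
  fix k :: nat
  have "measure M {\<omega> \<in> space M. card (X \<omega> \<inter> B) = k} = measure N {\<omega> \<in> space N. card (X' \<omega> \<inter> B) = k}"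
    using X X' B by (simp add: poisson_process_def)
  moreover have "(\<lambda>\<omega>. card (X \<omega> \<inter> B)) -` {k} \<inter> space M = {\<omega> \<in> space M. card (X \<omega> \<inter> B) = k}"
    "(\<lambda>\<omega>. card (X' \<omega> \<inter> B)) -` {k} \<inter> space N = {\<omega> \<in> space N. card (X' \<omega> \<inter> B) = k}" by auto
  ultimately show "emeasure (distr M (count_space UNIV) (\<lambda>\<omega>. card (X \<omega> \<inter> B))) {k}
      = emeasure (distr N (count_space UNIV) (\<lambda>\<omega>. card (X' \<omega> \<inter> B))) {k}"
    by (simp add: emeasure_distr M.emeasure_eq_measure N.emeasure_eq_measure)
qed auto

text \<open>Independence makes each joint law the product of its one-dimensional laws, and those are
  the Poisson laws prescribed by the density.\<close>

lemma poisson_process_counts_distr: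
  assumes M: "prob_space M" and N: "prob_space N"
    and X: "poisson_process M \<rho> X" and X': "poisson_process N \<rho> X'"
    and B: "\<And>i::nat. bounded (B i)" "\<And>i. B i \<in> sets borel" and disj: "disjoint_family B"
  shows "distr M (\<Pi>\<^sub>M i\<in>UNIV. count_space UNIV) (\<lambda>\<omega> i. card (X \<omega> \<inter> B i)) =
         distr N (\<Pi>\<^sub>M i\<in>UNIV. count_space UNIV) (\<lambda>\<omega> i. card (X' \<omega> \<inter> B i))"
proof -
  have *: "distr L (\<Pi>\<^sub>M i\<in>UNIV. count_space UNIV) (\<lambda>\<omega> i. card (Z \<omega> \<inter> B i)) =
      (\<Pi>\<^sub>M i\<in>UNIV. distr L (count_space UNIV) (\<lambda>\<omega>. card (Z \<omega> \<inter> B i)))"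
    if "prob_space L" "poisson_process L \<rho> Z" for L :: "'z measure" and Z
  proof -
    interpret prob_space L by fact
    have [measurable]: "Z \<in> measurable L point_configs"
      using that by (auto simp: poisson_process_def)
    have "indep_vars (\<lambda>_. count_space UNIV) (\<lambda>i \<omega>. card (Z \<omega> \<inter> B i)) UNIV"
      using that B disj by (auto simp: poisson_process_def)
    moreover have "random_variable (count_space UNIV) (\<lambda>\<omega>. card (Z \<omega> \<inter> B i))" for i
      using measurable_count[OF B, measurable] by measurable
    ultimately show ?thesis
      by (subst (asm) indep_vars_iff_distr_eq_PiM) (auto simp: restrict_UNIV)
  qed
  show ?thesis
    using *[OF M X] *[OF N X'] poisson_process_count_distr[OF M N X X' B] by simp
qed

text \<open>
  The \<open>j\<close>-th atom of the algebra generated by \<open>B 0, \<dots>, B (n - 1)\<close> consists of the points that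
  lie in exactly those \<open>B i\<close> for which bit \<open>i\<close> of \<open>j\<close> is set.
\<close>

lemma card_Int_eq_sum_atoms:
  fixes B :: "nat \<Rightarrow> 'a set"
  assumes "finite (S \<inter> (\<Union>i<n. B i))" and "i < n"
  shows "card (S \<inter> B i) = (\<Sum>j \<in> {j \<in> set_encode ` Pow {..<n}. i \<in> set_decode j}.
           card (S \<inter> {x \<in> \<Union>i<n. B i. \<forall>i. (i < n \<and> x \<in> B i) = (i \<in> set_decode j)}))" (is "_ = (\<Sum>j\<in>?J. card (S \<inter> ?A j))")
proof -
  have "S \<inter> B i = (\<Union>j\<in>?J. S \<inter> ?A j)"
  proof (intro equalityI subsetI)
    fix x assume x: "x \<in> S \<inter> B i"
    let ?D = "{i. i < n \<and> x \<in> B i}"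
    have "finite ?D" "?D \<in> Pow {..<n}" by auto
    then have "set_encode ?D \<in> ?J" "x \<in> S \<inter> ?A (set_encode ?D)"
      using x \<open>i < n\<close> by (auto simp: set_encode_inverse)
    then show "x \<in> (\<Union>j\<in>?J. S \<inter> ?A j)" by blast
  qed auto
  moreover have "disjoint_family_on (\<lambda>j. S \<inter> ?A j) ?J"
    unfolding disjoint_family_on_def
  proof (intro ballI impI, rule ccontr)
    fix j k assume "j \<noteq> k" "S \<inter> ?A j \<inter> (S \<inter> ?A k) \<noteq> {}"
    then have "set_decode j = set_decode k" by auto
    then show False using \<open>j \<noteq> k\<close> by (metis set_decode_inverse)
  qed
  moreover have "finite ?J" by auto
  moreover have "finite (S \<inter> ?A j)" for j
    using assms(1) by (rule rev_finite_subset) auto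
  ultimately show ?thesis
    by (simp only: disjoint_family_on_def) (rule card_UN_disjoint, auto)
qed

text \<open>A Dynkin argument: the events \<open>cyl F\<close>, which prescribe finitely many
  counts, are closed under intersection and generate \<open>point_configs\<close>. The sets in
  \<open>F\<close> may overlap, so their counts are first written as sums of counts in disjoint
  atoms, whose joint law is known.\<close>

lemma poisson_process_unique:
  assumes M: "prob_space M" and N: "prob_space N"
    and X: "poisson_process M \<rho> X" and X': "poisson_process N \<rho> X'"
  shows "distr M point_configs X = distr N point_configs X'"
proof -
  interpret M: prob_space M by fact
  interpret N: prob_space N by fact
  have [measurable]: "X \<in> measurable M point_configs" "X' \<in> measurable N point_configs"
    using X X' by (auto simp: poisson_process_def)
  define \<B> :: "plane set set" where "\<B> = {B. bounded B \<and> B \<in> sets borel}"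
  define cyl where "cyl F = {S \<in> space point_configs. \<forall>(B, k) \<in> F. card (S \<inter> B) = k}" for F :: "(plane set \<times> nat) set"
  define E where "E = {cyl F | F. finite F \<and> F \<subseteq> \<B> \<times> UNIV}"
  have cyl_sets: "cyl F \<in> sets point_configs" if "finite F" "F \<subseteq> \<B> \<times> UNIV" for F
    unfolding cyl_def case_prod_beta
    by (rule sets.sets_Collect_finite_All) (use that in \<open>auto simp: \<B>_def intro!: count_sets_point_configs\<close>)
  have sets_eq: "sets point_configs = sigma_sets (space point_configs) E"
  proof (intro equalityI)
    show "sets point_configs \<subseteq> sigma_sets (space point_configs) E"
      unfolding sets_point_configs
    proof (rule sigma_sets_mono', clarify)
      fix B :: "plane set" and k assume "bounded B" "B \<in> sets borel"
      then show "{S \<in> space point_configs. card (S \<inter> B) = k} \<in> E"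
        unfolding E_def by (intro CollectI exI[of _ "{(B, k)}"]) (auto simp: cyl_def \<B>_def)
    qed
    show "sigma_sets (space point_configs) E \<subseteq> sets point_configs"
      using cyl_sets by (intro sets.sigma_sets_subset) (auto simp: E_def)
  qed
  have eq: "emeasure (distr M point_configs X) (cyl F) = emeasure (distr N point_configs X') (cyl F)"
    if F: "finite F" "F \<subseteq> \<B> \<times> UNIV" for F
  proof -
    obtain n and B :: "nat \<Rightarrow> plane set" where B: "fst ` F = B ` {..<n}"
      using ex_bij_betw_nat_finite[of "fst ` F"] F(1)
      by (metis atLeast0LessThan bij_betw_imp_surj_on finite_imageI)
    have B_in: "B i \<in> \<B>" if "i < n" for i
    proof -
      have "fst ` F \<subseteq> \<B>" using F(2) by auto
      then show ?thesis using that B by auto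
    qed
    have B': "bounded (B i)" "B i \<in> sets borel" if "i < n" for i
      using B_in[OF that] by (auto simp: \<B>_def)
    \<comment> \<open>A code \<open>j\<close> with a bit at or beyond \<open>n\<close> gives the
      empty set, and so does \<open>j = 0\<close>. The finitely many atoms are thereby padded to the
      infinite disjoint sequence that \<open>poisson_process\<close> speaks about, and restricting
      to the union keeps all of them bounded.\<close>
    define A where "A j = {x \<in> \<Union>i<n. B i. \<forall>i. (i < n \<and> x \<in> B i) = (i \<in> set_decode j)}" for j
    have bdd: "bounded (\<Union>i<n. B i)" using B' by auto
    have A: "bounded (A j)" "A j \<in> sets borel" for j
    proof -
      show "bounded (A j)" using bdd by (rule bounded_subset) (auto simp: A_def)
      have "{x \<in> space borel. (i < n \<and> x \<in> B i) = (i \<in> set_decode j)} =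
          (if i < n then if i \<in> set_decode j then B i else - B i else if i \<in> set_decode j then {} else UNIV)" for i
        by auto
      then have "{x \<in> space borel. (i < n \<and> x \<in> B i) = (i \<in> set_decode j)} \<in> sets borel" for i
        using B'(2)[of i] by (simp add: borel_comp)
      then have "{x \<in> space borel. \<forall>i. (i < n \<and> x \<in> B i) = (i \<in> set_decode j)} \<in> sets borel"
        by (intro sets.sets_Collect_countable_All)
      moreover have "(\<Union>i<n. B i) \<in> sets borel" using B' by (intro sets.finite_UN) auto
      moreover have "A j = (\<Union>i<n. B i) \<inter> {x \<in> space borel. \<forall>i. (i < n \<and> x \<in> B i) = (i \<in> set_decode j)}"
        unfolding A_def space_borel by blast
      ultimately show "A j \<in> sets borel" by (simp only: sets.Int)
    qed
    have disj: "disjoint_family A"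
      unfolding disjoint_family_on_def
    proof (intro ballI impI, rule ccontr)
      fix j k assume "j \<noteq> k" "A j \<inter> A k \<noteq> {}"
      then have "set_decode j = set_decode k" by (auto simp: A_def)
      then show False using \<open>j \<noteq> k\<close> by (metis set_decode_inverse)
    qed
    define J where "J i = {j \<in> set_encode ` Pow {..<n}. i \<in> set_decode j}" for i
    define Q where "Q = {f \<in> space (\<Pi>\<^sub>M j\<in>UNIV. count_space (UNIV :: nat set)).
      \<forall>i\<in>{..<n}. \<forall>k\<in>snd ` F. (B i, k) \<in> F \<longrightarrow> (\<Sum>j\<in>J i. f j) = (k::nat)}"
    have Q: "Q \<in> sets (\<Pi>\<^sub>M j\<in>UNIV. count_space (UNIV :: nat set))"
      unfolding Q_def
      by (intro sets.sets_Collect_finite_All sets.sets_Collect_imp sets.sets_Collect_const)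
        (use F(1) in auto)
    have Q_iff: "S \<in> cyl F \<longleftrightarrow> (\<lambda>j. card (S \<inter> A j)) \<in> Q" if S: "S \<in> space point_configs" for S
    proof -
      have *: "card (S \<inter> B i) = (\<Sum>j\<in>J i. card (S \<inter> A j))" if "i < n" for i
        unfolding J_def A_def using finite_config_Int[OF S bdd] that by (rule card_Int_eq_sum_atoms)
      have "S \<in> cyl F \<longleftrightarrow> (\<forall>i<n. \<forall>k\<in>snd ` F. (B i, k) \<in> F \<longrightarrow> card (S \<inter> B i) = k)"
      proof
        show "\<forall>i<n. \<forall>k\<in>snd ` F. (B i, k) \<in> F \<longrightarrow> card (S \<inter> B i) = k" if "S \<in> cyl F"
          using that by (auto simp: cyl_def)
        assume R: "\<forall>i<n. \<forall>k\<in>snd ` F. (B i, k) \<in> F \<longrightarrow> card (S \<inter> B i) = k"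
        have "card (S \<inter> C) = k" if "(C, k) \<in> F" for C k
        proof -
          have "C \<in> B ` {..<n}" using that B by (metis fst_conv image_eqI)
          then show ?thesis using R that by (metis image_iff lessThan_iff snd_conv)
        qed
        then show "S \<in> cyl F" using S by (auto simp: cyl_def)
      qed
      also have "\<dots> \<longleftrightarrow> (\<lambda>j. card (S \<inter> A j)) \<in> Q"
        using * by (auto simp: Q_def space_PiM)
      finally show ?thesis .
    qed
    have *: "emeasure (distr L point_configs Z) (cyl F) =
        emeasure (distr L (\<Pi>\<^sub>M i\<in>UNIV. count_space UNIV) (\<lambda>\<omega> i. card (Z \<omega> \<inter> A i))) Q"
      if [measurable]: "Z \<in> measurable L point_configs" for L :: "'z measure" and Z
    proof -
      have [measurable]: "(\<lambda>\<omega> i. card (Z \<omega> \<inter> A i)) \<in> measurable L (\<Pi>\<^sub>M i\<in>UNIV. count_space UNIV)"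
        using measurable_count[OF A, measurable] by (intro measurable_PiM_single') (auto simp: space_PiM)
      have "Z -` cyl F \<inter> space L = (\<lambda>\<omega> i. card (Z \<omega> \<inter> A i)) -` Q \<inter> space L"
        using Q_iff measurable_space[OF that] by auto
      then show ?thesis
        using cyl_sets[OF F] Q by (simp add: emeasure_distr)
    qed
    show ?thesis
      using *[of X M] *[of X' N] poisson_process_counts_distr[OF M N X X' A disj] by simp
  qed
  show ?thesis
  proof (rule measure_eqI_generator_eq[where E=E and \<Omega>="space point_configs" and A="\<lambda>_. space point_configs"])
    show "Int_stable E"
    proof (rule Int_stableI)
      fix a b assume "a \<in> E" "b \<in> E"
      then obtain F G where "a = cyl F" "finite F" "F \<subseteq> \<B> \<times> UNIV" "b = cyl G" "finite G" "G \<subseteq> \<B> \<times> UNIV"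
        by (auto simp: E_def)
      moreover have "cyl F \<inter> cyl G = cyl (F \<union> G)" by (auto simp: cyl_def ball_Un)
      ultimately show "a \<inter> b \<in> E" unfolding E_def by (metis (mono_tags, lifting) finite_UnI le_sup_iff mem_Collect_eq)
    qed
    show "range (\<lambda>_::nat. space point_configs) \<subseteq> E"
      unfolding E_def by (auto intro!: exI[of _ "{}"] simp: cyl_def)
    show "emeasure (distr M point_configs X) (space point_configs) \<noteq> \<infinity>" for i :: nat
      by (simp add: M.emeasure_eq_measure emeasure_distr)
  qed (use eq sets_eq in \<open>auto simp: E_def cyl_def\<close>)
qed

section \<open>Scaling of the plane\<close>

lemma vimage_scaleR_eq_image:
  fixes B :: "'a::real_vector set"
  assumes "c \<noteq> 0" shows "(\<lambda>x. c *\<^sub>R x) -` B = (\<lambda>x. inverse c *\<^sub>R x) ` B"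
  using assms by (auto simp: image_iff) (metis inverse_inverse_eq left_inverse nonzero_imp_inverse_nonzero scaleR_one scaleR_scaleR)

lemma bounded_vimage_scaleR: "c \<noteq> 0 \<Longrightarrow> bounded B \<Longrightarrow> bounded ((\<lambda>x. c *\<^sub>R x) -` B)"
  for B :: "'a::real_normed_vector set"
  by (simp add: vimage_scaleR_eq_image bounded_scaling)

lemma vimage_scaleR_borel: "B \<in> sets borel \<Longrightarrow> (\<lambda>x. c *\<^sub>R x) -` B \<in> sets borel"
  for B :: "'a::euclidean_space set"
  using measurable_sets_borel[of "\<lambda>x::'a. c *\<^sub>R x" borel B] by simp

lemma emeasure_lborel_vimage_scaleR:
  fixes B :: "'a::euclidean_space set"
  assumes c: "c > 0" and B: "B \<in> sets borel"
  shows "emeasure lborel B = ennreal (c ^ DIM('a)) * emeasure lborel ((\<lambda>x. c *\<^sub>R x) -` B)"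
proof -
  have "emeasure lborel B = emeasure (density (distr lborel borel (\<lambda>x::'a. 0 + c *\<^sub>R x)) (\<lambda>_. \<bar>c\<bar>^DIM('a))) B"
    using c by (subst lborel_affine[of c 0]) auto
  also have "\<dots> = ennreal (c ^ DIM('a)) * emeasure lborel ((\<lambda>x. c *\<^sub>R x) -` B)"
    using c B by (simp add: emeasure_density_const emeasure_distr)
  finally show ?thesis .
qed

lemma card_image_scaleR_Int:
  fixes B :: "'a::real_vector set"
  assumes "c \<noteq> 0"
  shows "card ((\<lambda>x. c *\<^sub>R x) ` S \<inter> B) = card (S \<inter> (\<lambda>x. c *\<^sub>R x) -` B)"
proof -
  have "(\<lambda>x. c *\<^sub>R x) ` S \<inter> B = (\<lambda>x. c *\<^sub>R x) ` (S \<inter> (\<lambda>x. c *\<^sub>R x) -` B)" by auto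
  then show ?thesis using assms by (simp add: card_image inj_on_def)
qed

text \<open>Counting scaled points in \<open>B\<close> is counting the original points in the
  preimage of \<open>B\<close>. Preimages stay bounded, Borel and disjoint, and their area is that
  of \<open>B\<close> divided by \<open>c\<^sup>2\<close>, which becomes the change of
  density.\<close>

lemma poisson_process_scaleR:
  assumes X: "poisson_process M \<rho> X" and c: "c > 0"
  shows "poisson_process M (\<rho> / c\<^sup>2) (\<lambda>\<omega>. (\<lambda>x. c *\<^sub>R x) ` X \<omega>)"
proof -
  let ?s = "\<lambda>x::plane. c *\<^sub>R x"
  have X1: "X \<in> measurable M point_configs"
    and X2: "\<And>B k. bounded B \<Longrightarrow> B \<in> sets borel \<Longrightarrow> measure M {\<omega> \<in> space M. card (X \<omega> \<inter> B) = k} =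
          exp (- (\<rho> * measure lborel B)) * (\<rho> * measure lborel B) ^ k / fact k"
    and X3: "\<And>B :: nat \<Rightarrow> plane set. (\<And>i. bounded (B i) \<and> B i \<in> sets borel) \<Longrightarrow> disjoint_family B \<Longrightarrow>
        prob_space.indep_vars M (\<lambda>_. count_space UNIV) (\<lambda>i \<omega>. card (X \<omega> \<inter> B i)) UNIV"
    using X by (auto simp: poisson_process_def)
  have card_eq: "card (?s ` S \<inter> B) = card (S \<inter> ?s -` B)" for S B
    using c by (intro card_image_scaleR_Int) simp
  have vim: "bounded (?s -` B)" "?s -` B \<in> sets borel" if "bounded B" "B \<in> sets borel" for B
    using c that by (auto intro: bounded_vimage_scaleR vimage_scaleR_borel)
  have meas: "\<rho> / c\<^sup>2 * measure lborel B = \<rho> * measure lborel (?s -` B)" if "B \<in> sets borel" for B :: "plane set"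
    using emeasure_lborel_vimage_scaleR[OF c that] c
    by (simp add: measure_def enn2real_mult)
  show ?thesis
    unfolding poisson_process_def card_eq
  proof (intro conjI allI impI)
    show "(\<lambda>\<omega>. ?s ` X \<omega>) \<in> measurable M point_configs"
    proof (rule measurable_point_configsI)
      fix \<omega> assume "\<omega> \<in> space M"
      then have "X \<omega> \<in> space point_configs" using X1 by (rule measurable_space[rotated])
      moreover have "?s ` S \<inter> B = ?s ` (S \<inter> ?s -` B)" for S B by auto
      ultimately show "?s ` X \<omega> \<in> space point_configs"
        using c by (auto simp: space_point_configs bounded_vimage_scaleR)
    next
      fix B :: "plane set" and k assume "bounded B" "B \<in> sets borel"
      note [measurable] = X1 measurable_count[OF vim[OF this]]
      show "{\<omega> \<in> space M. card (?s ` X \<omega> \<inter> B) = k} \<in> sets M"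
        unfolding card_eq by measurable
    qed
  next
    fix B :: "plane set" and k assume B: "bounded B \<and> B \<in> sets borel"
    then show "measure M {\<omega> \<in> space M. card (X \<omega> \<inter> ?s -` B) = k} =
        exp (- (\<rho> / c\<^sup>2 * measure lborel B)) * (\<rho> / c\<^sup>2 * measure lborel B) ^ k / fact k"
      using X2[of "?s -` B" k] vim[of B] meas[of B] by simp
  next
    fix B :: "nat \<Rightarrow> plane set" assume B: "(\<forall>i. bounded (B i) \<and> B i \<in> sets borel) \<and> disjoint_family B"
    then have "disjoint_family (\<lambda>i. ?s -` B i)" by (auto simp: disjoint_family_on_def)
    then show "prob_space.indep_vars M (\<lambda>_. count_space UNIV) (\<lambda>i \<omega>. card (X \<omega> \<inter> ?s -` B i)) UNIV"
      using B vim by (intro X3) auto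
  qed
qed

section \<open>The points of a Poisson process ordered by norm\<close>

text \<open>
  For a configuration with distinct norms, \<open>nth_point_in n B\<close> says that its \<open>n\<close>-th point by norm
  (counting from 1) lies in \<open>B\<close>; the rational radii separate this point from its neighbours.
\<close>

definition nth_point_in :: "nat \<Rightarrow> plane set \<Rightarrow> plane set set" where
  "nth_point_in n B = {S \<in> space point_configs. \<exists>a b. a < b \<and>
     card (S \<inter> cball 0 (of_rat a)) = n - 1 \<and> card (S \<inter> cball 0 (of_rat b)) = n \<and>
     card (S \<inter> ((cball 0 (of_rat b) - cball 0 (of_rat a)) \<inter> B)) = 1}"

lemma nth_point_in_sets:
  assumes "B \<in> sets borel" shows "nth_point_in n B \<in> sets point_configs"
  unfolding nth_point_in_def
  by (intro sets.sets_Collect_countable_Ex sets.sets_Collect_conj sets.sets_Collect_const count_sets_point_configs)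
    (use assms in \<open>auto intro: bounded_Int bounded_diff bounded_subset[OF bounded_cball]\<close>)

text \<open>Applied to the labels of the points in a ball around the origin: as these are closed
  downwards, the mere count tells which points the ball contains.\<close>

lemma initial_segment_eq:
  fixes D :: "nat set"
  assumes "finite D" "0 \<notin> D" "\<And>i j. 0 < i \<Longrightarrow> i \<le> j \<Longrightarrow> j \<in> D \<Longrightarrow> i \<in> D"
  shows "D = {1..card D}"
proof (cases "D = {}")
  case False
  have "D = {1..Max D}"
  proof
    show "D \<subseteq> {1..Max D}" using assms(1,2) by (metis Max_ge atLeastAtMost_iff less_one not_le subsetI)
    show "{1..Max D} \<subseteq> D" using assms(3)[OF _ _ Max_in[OF assms(1) False]] by auto
  qed
  then show ?thesis by (metis card_atLeastAtMost diff_Suc_1 Suc_eq_plus1)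
qed simp

text \<open>A centred ball with \<open>k\<close> points contains exactly those labelled 1 to
  \<open>k\<close>. Balls with \<open>n - 1\<close> and \<open>n\<close> points therefore differ in
  the point \<open>y n\<close> alone, and one more count tells whether it lies in
  \<open>B\<close>.\<close>

lemma nth_point_in_iff:
  assumes y0: "y 0 = 0" and mono: "strict_mono (\<lambda>n. norm (y n))"
    and S: "y ` {1..} \<in> space point_configs" and n: "n \<ge> 1"
  shows "y ` {1..} \<in> nth_point_in n B \<longleftrightarrow> y n \<in> B"
proof -
  let ?S = "y ` {1..}"
  have inj: "inj y" using mono by (metis (mono_tags, lifting) inj_def strict_mono_eq)
  have less: "norm (y i) < norm (y j) \<longleftrightarrow> i < j" for i j using mono by (rule strict_mono_less)
  have le: "norm (y i) \<le> norm (y j) \<longleftrightarrow> i \<le> j" for i j using mono by (rule strict_mono_less_eq)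
  define D where "D r = {m. 1 \<le> m \<and> norm (y m) \<le> r}" for r
  have Int_eq: "?S \<inter> cball 0 r = y ` D r" for r by (auto simp: D_def)
  have fin: "finite (D r)" for r
    using finite_config_Int[OF S bounded_cball[of 0 r]] inj unfolding Int_eq
    by (meson finite_imageD inj_on_subset subset_UNIV)
  have card_eq: "card (?S \<inter> cball 0 r) = card (D r)" for r
    unfolding Int_eq using inj by (meson card_image inj_on_subset subset_UNIV)
  have D_eq: "D r = {1..card (D r)}" for r
    by (rule initial_segment_eq[OF fin]) (auto simp: D_def intro: order_trans[of "norm (y _)" "norm (y _)"] dest: le[THEN iffD2])
  have annulus: "?S \<inter> (cball 0 b - cball 0 a) = y ` (D b - D a)" for a b
  proof -
    have "?S \<inter> (cball 0 b - cball 0 a) = (?S \<inter> cball 0 b) - (?S \<inter> cball 0 a)" by blast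
    then show ?thesis unfolding Int_eq using image_set_diff[OF inj] by simp
  qed
  show ?thesis
  proof
    assume "?S \<in> nth_point_in n B"
    then obtain a b :: real where ab: "card (?S \<inter> cball 0 a) = n - 1" "card (?S \<inter> cball 0 b) = n"
      "card (?S \<inter> ((cball 0 b - cball 0 a) \<inter> B)) = 1"
      unfolding nth_point_in_def by auto
    have "D a = {1..n - 1}" "D b = {1..n}" using ab(1,2) D_eq unfolding card_eq by metis+
    then have "D b - D a = {n}" using n by auto
    have "?S \<inter> (cball 0 b - cball 0 a) = y ` (D b - D a)" by (rule annulus)
    also have "\<dots> = {y n}" unfolding \<open>D b - D a = {n}\<close> by simp
    finally have "?S \<inter> ((cball 0 b - cball 0 a) \<inter> B) = {y n} \<inter> B" by blast
    with ab(3) show "y n \<in> B" by (cases "y n \<in> B") auto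
  next
    assume "y n \<in> B"
    \<comment> \<open>For \<open>n = 1\<close> the inner neighbour is \<open>y 0\<close>; its norm
      bounds \<open>a\<close> from below, but \<open>D\<close> starts at label 1 and does not count
      it.\<close>
    obtain a where a: "norm (y (n - 1)) < real_of_rat a" "real_of_rat a < norm (y n)"
      using of_rat_dense[of "norm (y (n - 1))" "norm (y n)"] less n by auto
    obtain b where b: "norm (y n) < real_of_rat b" "real_of_rat b < norm (y (Suc n))"
      using of_rat_dense[of "norm (y n)" "norm (y (Suc n))"] less by auto
    have Da: "D (of_rat a) = {1..n - 1}"
    proof (intro set_eqI iffI)
      fix m assume "m \<in> D (of_rat a)"
      then have "1 \<le> m" "norm (y m) < norm (y n)" using a by (auto simp: D_def)
      then show "m \<in> {1..n - 1}" using less by auto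
    next
      fix m assume "m \<in> {1..n - 1}"
      then have "1 \<le> m" "norm (y m) \<le> norm (y (n - 1))" using le by auto
      then show "m \<in> D (of_rat a)" using a by (auto simp: D_def)
    qed
    have Db: "D (of_rat b) = {1..n}"
    proof (intro set_eqI iffI)
      fix m assume "m \<in> D (of_rat b)"
      then have "1 \<le> m" "norm (y m) < norm (y (Suc n))" using b by (auto simp: D_def)
      then show "m \<in> {1..n}" using less by auto
    next
      fix m assume "m \<in> {1..n}"
      then have "1 \<le> m" "norm (y m) \<le> norm (y n)" using le by auto
      then show "m \<in> D (of_rat b)" using b by (auto simp: D_def)
    qed
    have "?S \<inter> (cball 0 (of_rat b) - cball 0 (of_rat a)) = y ` (D (of_rat b) - D (of_rat a))"
      by (rule annulus)
    also have "D (of_rat b) - D (of_rat a) = {n}" unfolding Da Db using n by auto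
    finally have "?S \<inter> ((cball 0 (of_rat b) - cball 0 (of_rat a)) \<inter> B) = {y n}"
      using \<open>y n \<in> B\<close> by blast
    then have "card (?S \<inter> ((cball 0 (of_rat b) - cball 0 (of_rat a)) \<inter> B)) = 1" by simp
    moreover have "a < b" using a b by (metis less_trans of_rat_less)
    moreover have "card (?S \<inter> cball 0 (of_rat a)) = n - 1" "card (?S \<inter> cball 0 (of_rat b)) = n"
      unfolding card_eq Da Db by simp_all
    ultimately show "?S \<in> nth_point_in n B"
      using S unfolding nth_point_in_def by blast
  qed
qed

text \<open>Almost surely the labels can be recovered from the unlabelled set, so the law of the set
  determines the joint law of the labelled points. Label 0 sits at the origin outside the process,
  which turns its constraint into the deterministic condition \<open>0 \<in> A 0\<close>.\<close>

lemma labelled_poisson_process_emeasure: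
  assumes Y: "\<And>n. Y n \<in> borel_measurable M" and Y0: "\<And>\<omega>. \<omega> \<in> space M \<Longrightarrow> Y 0 \<omega> = 0"
    and mono: "AE \<omega> in M. strict_mono (\<lambda>n. norm (Y n \<omega>))"
    and X: "(\<lambda>\<omega>. (\<lambda>n. Y n \<omega>) ` {1..}) \<in> measurable M point_configs"
    and J: "finite J" and A: "\<And>j. j \<in> J \<Longrightarrow> A j \<in> sets borel"
  shows "emeasure M {\<omega> \<in> space M. \<forall>j\<in>J. Y j \<omega> \<in> A j} =
    emeasure (distr M point_configs (\<lambda>\<omega>. (\<lambda>n. Y n \<omega>) ` {1..}))
      {S \<in> space point_configs. \<forall>j\<in>J. (j = 0 \<longrightarrow> 0 \<in> A 0) \<and> (j \<noteq> 0 \<longrightarrow> S \<in> nth_point_in j (A j))}"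
proof -
  let ?X = "\<lambda>\<omega>. (\<lambda>n. Y n \<omega>) ` {1..}"
  let ?G = "{S \<in> space point_configs. \<forall>j\<in>J. (j = 0 \<longrightarrow> 0 \<in> A 0) \<and> (j \<noteq> 0 \<longrightarrow> S \<in> nth_point_in j (A j))}"
  have "nth_point_in j (A j) \<in> sets point_configs" if "j \<in> J" for j
    using nth_point_in_sets[OF A[OF that]] .
  then have "{S \<in> space point_configs. S \<in> nth_point_in j (A j)} \<in> sets point_configs" if "j \<in> J" for j
    using that by (metis (no_types, lifting) Collect_cong Int_def sets.Int_space_eq1)
  then have G: "?G \<in> sets point_configs"
    using J by (intro sets.sets_Collect_finite_All sets.sets_Collect_conj sets.sets_Collect_imp sets.sets_Collect_const) auto
  have "emeasure M {\<omega> \<in> space M. \<forall>j\<in>J. Y j \<omega> \<in> A j} = emeasure M (?X -` ?G \<inter> space M)"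
  proof (rule emeasure_eq_AE)
    show "AE \<omega> in M. (\<omega> \<in> {\<omega> \<in> space M. \<forall>j\<in>J. Y j \<omega> \<in> A j}) = (\<omega> \<in> ?X -` ?G \<inter> space M)"
      using mono
    proof (rule AE_mp, intro AE_I2 impI)
      fix \<omega> assume \<omega>: "\<omega> \<in> space M" and m: "strict_mono (\<lambda>n. norm (Y n \<omega>))"
      have S: "?X \<omega> \<in> space point_configs" using X \<omega> by (rule measurable_space)
      have "?X \<omega> \<in> nth_point_in j (A j) \<longleftrightarrow> Y j \<omega> \<in> A j" if "j \<noteq> 0" for j
        using nth_point_in_iff[of "\<lambda>n. Y n \<omega>" j "A j", OF Y0[OF \<omega>] m S] that by simp
      then show "(\<omega> \<in> {\<omega> \<in> space M. \<forall>j\<in>J. Y j \<omega> \<in> A j}) = (\<omega> \<in> ?X -` ?G \<inter> space M)"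
        using \<omega> S Y0[OF \<omega>] by auto
    qed
    show "{\<omega> \<in> space M. \<forall>j\<in>J. Y j \<omega> \<in> A j} \<in> sets M"
      using J A Y by (intro sets.sets_Collect_finite_All) auto
    show "?X -` ?G \<inter> space M \<in> sets M" using X G by (rule measurable_sets)
  qed
  also have "\<dots> = emeasure (distr M point_configs ?X) ?G"
    using X G by (rule emeasure_distr[symmetric])
  finally show ?thesis .
qed

section \<open>Laws of random sequences\<close>

lemma measurable_sequence:
  "(\<And>n. Y n \<in> borel_measurable M) \<Longrightarrow> (\<lambda>\<omega> n. Y n \<omega>) \<in> measurable M (\<Pi>\<^sub>M n\<in>UNIV. borel)"
  by (intro measurable_PiM_single') (auto simp: space_PiM)

text \<open>Any finite cylinder is an event on an initial segment of coordinates, with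
  \<open>UNIV\<close> at the unconstrained ones, and finite cylinders determine a finite measure on
  the product space.\<close>

lemma sequence_distr_eqI:
  fixes Y :: "nat \<Rightarrow> 'w \<Rightarrow> 'b::topological_space" and Y' :: "nat \<Rightarrow> 'v \<Rightarrow> 'b"
  assumes M: "prob_space M"
    and Y: "\<And>n. Y n \<in> borel_measurable M" and Y': "\<And>n. Y' n \<in> borel_measurable N"
    and eq: "\<And>n B. (\<And>i. B i \<in> sets borel) \<Longrightarrow>
      emeasure M {\<omega> \<in> space M. \<forall>i\<le>n. Y i \<omega> \<in> B i} = emeasure N {\<omega> \<in> space N. \<forall>i\<le>n. Y' i \<omega> \<in> B i}"
  shows "distr M (\<Pi>\<^sub>M n\<in>UNIV. borel) (\<lambda>\<omega> n. Y n \<omega>) = distr N (\<Pi>\<^sub>M n\<in>UNIV. borel) (\<lambda>\<omega> n. Y' n \<omega>)"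
proof (rule measure_eqI_PiM_infinite)
  note [measurable] = measurable_sequence[of Y, OF Y] measurable_sequence[of Y', OF Y']
  interpret M: prob_space "distr M (\<Pi>\<^sub>M n\<in>UNIV. borel) (\<lambda>\<omega> n. Y n \<omega>)"
    using M by (rule prob_space.prob_space_distr) measurable
  show "finite_measure (distr M (\<Pi>\<^sub>M n\<in>UNIV. borel) (\<lambda>\<omega> n. Y n \<omega>))" by unfold_locales
  fix J :: "nat set" and A :: "nat \<Rightarrow> 'b set"
  assume J: "finite J" and A: "\<And>i. i \<in> J \<Longrightarrow> A i \<in> sets borel"
  define B where "B i = (if i \<in> J then A i else UNIV)" for i
  obtain n where n: "J \<subseteq> {..n}" using J finite_nat_iff_bounded_le by auto
  have P: "prod_emb UNIV (\<lambda>_. borel) J (Pi\<^sub>E J A) \<in> sets (\<Pi>\<^sub>M n\<in>UNIV. borel)"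
    using J A by (intro sets_PiM_I) auto
  have emb: "prod_emb UNIV (\<lambda>_. borel) J (Pi\<^sub>E J A) = {f. \<forall>i\<le>n. f i \<in> B i}"
    using n by (auto simp: prod_emb_def B_def PiE_iff subset_iff split: if_splits)
  have *: "emeasure (distr L (\<Pi>\<^sub>M n\<in>UNIV. borel) (\<lambda>\<omega> n. Z n \<omega>)) (prod_emb UNIV (\<lambda>_. borel) J (Pi\<^sub>E J A))
      = emeasure L {\<omega> \<in> space L. \<forall>i\<le>n. Z i \<omega> \<in> B i}"
    if "\<And>n. Z n \<in> borel_measurable L" for L :: "'z measure" and Z
    using P measurable_sequence[of Z L, OF that] unfolding emb
    by (simp add: emeasure_distr vimage_def Int_def conj_commute)
  show "emeasure (distr M (\<Pi>\<^sub>M n\<in>UNIV. borel) (\<lambda>\<omega> n. Y n \<omega>)) (prod_emb UNIV (\<lambda>_. borel) J (Pi\<^sub>E J A)) =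
    emeasure (distr N (\<Pi>\<^sub>M n\<in>UNIV. borel) (\<lambda>\<omega> n. Y' n \<omega>)) (prod_emb UNIV (\<lambda>_. borel) J (Pi\<^sub>E J A))"
    unfolding *[of Y M, OF Y] *[of Y' N, OF Y'] using A by (intro eq) (auto simp: B_def)
qed auto

section \<open>The law of the mobiles\<close>

text \<open>Needed for the algebra generated by the stations to be a subalgebra of \<open>M\<close>,
  without which the conditional expectation in \<open>uplink_network\<close> could not be
  integrated.\<close>

lemma measurable_stations:
  assumes "\<And>\<omega>. \<omega> \<in> space M \<Longrightarrow> Y 0 \<omega> = 0"
    and X: "(\<lambda>\<omega>. (\<lambda>n. Y n \<omega>) ` {1..}) \<in> measurable M point_configs"
  shows "stations Y \<in> measurable M point_configs"
proof (rule measurable_point_configsI)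
  have stations_eq: "stations Y \<omega> = insert 0 ((\<lambda>n. Y n \<omega>) ` {1..})" if "\<omega> \<in> space M" for \<omega>
  proof -
    have "(UNIV :: nat set) = insert 0 {1..}" by auto
    then show ?thesis using assms(1)[OF that] unfolding stations_def by (metis image_insert)
  qed
  have config: "(\<lambda>n. Y n \<omega>) ` {1..} \<in> space point_configs" if "\<omega> \<in> space M" for \<omega>
    using X that by (rule measurable_space)
  show "stations Y \<omega> \<in> space point_configs" if "\<omega> \<in> space M" for \<omega>
    using config[OF that] unfolding stations_eq[OF that] by (simp add: space_point_configs Int_insert_left)
  fix B :: "plane set" and k assume B: "bounded B" "B \<in> sets borel"
  let ?X = "\<lambda>\<omega>. (\<lambda>n. Y n \<omega>) ` {1..}"
  \<comment> \<open>Taking the origin out of \<open>B\<close> prevents double counting on outcomes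
    where the process itself has a point there.\<close>
  have B0: "bounded (B - {0})" "B - {0} \<in> sets borel" using B by (auto intro: bounded_diff)
  have "card (stations Y \<omega> \<inter> B) = card (?X \<omega> \<inter> (B - {0})) + of_bool (0 \<in> B)" if "\<omega> \<in> space M" for \<omega>
  proof -
    have "stations Y \<omega> \<inter> B = (?X \<omega> \<inter> (B - {0})) \<union> ({0} \<inter> B)"
      unfolding stations_eq[OF that] by blast
    moreover have "finite (?X \<omega> \<inter> (B - {0}))" using config[OF that] B0(1) by (rule finite_config_Int)
    ultimately show ?thesis by (simp add: card_Un_disjoint)
  qed
  then have "{\<omega> \<in> space M. card (stations Y \<omega> \<inter> B) = k} =
      {\<omega> \<in> space M. card (?X \<omega> \<inter> (B - {0})) + of_bool (0 \<in> B) = k}" by auto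
  also have "\<dots> \<in> sets M"
    using measurable_compose[OF X measurable_count[OF B0]] by measurable
  finally show "{\<omega> \<in> space M. card (stations Y \<omega> \<inter> B) = k} \<in> sets M" .
qed

lemma voronoi_cell_borel: "voronoi_cell S y \<in> sets borel"
proof -
  have "voronoi_cell S y = (\<Inter>x\<in>S. {u. dist u y \<le> dist u x})"
    by (auto simp: voronoi_cell_def)
  moreover have "closed (\<Inter>x\<in>S. {u. dist u y \<le> dist u x})"
    by (intro closed_INT ballI closed_Collect_le continuous_intros)
  ultimately have "closed (voronoi_cell S y)" by simp
  then show ?thesis by simp
qed

text \<open>The probability is a quotient of areas of sections in \<open>u\<close>. That
  \<open>u\<close> lies in the cell of \<open>y i\<close> is a countable conjunction of distance
  comparisons, jointly measurable in \<open>y\<close> and \<open>u\<close>, so section areas are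
  measurable in \<open>y\<close>.\<close>

lemma measure_voronoi_measurable:
  assumes B: "B \<in> sets borel"
  shows "(\<lambda>y::nat \<Rightarrow> plane. measure (uniform_measure lborel (voronoi_cell (range y) (y i))) B)
    \<in> borel_measurable (\<Pi>\<^sub>M n\<in>UNIV. borel)"
proof -
  let ?P = "\<Pi>\<^sub>M n\<in>(UNIV::nat set). (borel :: plane measure)"
  have cell: "voronoi_cell (range y) (y i) = {u. \<forall>n. dist u (y i) \<le> dist u (y n)}" for y :: "nat \<Rightarrow> plane"
    by (auto simp: voronoi_cell_def)
  have coord: "(\<lambda>x. fst x n) \<in> borel_measurable (?P \<Otimes>\<^sub>M lborel)" for n
    by (rule measurable_compose[OF measurable_fst measurable_component_singleton]) simp
  have sec: "(\<lambda>y. emeasure lborel (voronoi_cell (range y) (y i) \<inter> C)) \<in> borel_measurable ?P"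
    if [measurable]: "C \<in> sets borel" for C
  proof (rule lborel.measurable_emeasure)
    have "{x \<in> space (?P \<Otimes>\<^sub>M lborel). (\<forall>n. dist (snd x) (fst x i) \<le> dist (snd x) (fst x n)) \<and> snd x \<in> C}
        \<in> sets (?P \<Otimes>\<^sub>M lborel)"
      using coord[measurable] by measurable
    then show "{x \<in> space (?P \<Otimes>\<^sub>M lborel). snd x \<in> voronoi_cell (range (fst x)) (fst x i) \<inter> C}
        \<in> sets (?P \<Otimes>\<^sub>M lborel)"
      unfolding cell by simp
  qed simp
  have "(\<lambda>y. emeasure lborel (voronoi_cell (range y) (y i) \<inter> B) / emeasure lborel (voronoi_cell (range y) (y i) \<inter> UNIV))
      \<in> borel_measurable ?P"
    using sec[OF B] sec[of UNIV] by (intro borel_measurable_divide_ennreal) auto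
  then show ?thesis
    using B by (simp add: measure_def voronoi_cell_borel)
qed

text \<open>Scaling multiplies all distances by \<open>c\<close> and so maps cells onto cells; the
  factor \<open>c\<^sup>2\<close> of the areas cancels in the quotient.\<close>

lemma measure_uniform_voronoi_scaleR:
  assumes c: "c > 0" and B: "B \<in> sets borel"
  shows "measure (uniform_measure lborel (voronoi_cell ((\<lambda>x. c *\<^sub>R x) ` S) (c *\<^sub>R y))) B =
    measure (uniform_measure lborel (voronoi_cell S y)) ((\<lambda>x. c *\<^sub>R x) -` B)"
proof -
  let ?s = "\<lambda>x::plane. c *\<^sub>R x" and ?V = "voronoi_cell ((\<lambda>x. c *\<^sub>R x) ` S) (c *\<^sub>R y)"
  have "dist (?s x) (?s z) = c * dist x z" for x z
    using c by (simp add: dist_norm flip: scaleR_diff_right)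
  then have vim: "?s -` ?V = voronoi_cell S y"
    using c by (auto simp: voronoi_cell_def)
  have e: "emeasure lborel (?V \<inter> C) = ennreal (c\<^sup>2) * emeasure lborel (voronoi_cell S y \<inter> ?s -` C)"
    if "C \<in> sets borel" for C
    using emeasure_lborel_vimage_scaleR[OF c, of "?V \<inter> C"] that voronoi_cell_borel
    by (simp add: vim sets.Int)
  \<comment> \<open>The factor is neither 0 nor infinite, so it cancels even if the area
    \<open>b\<close> of the cell is 0 or infinite.\<close>
  have "ennreal (c\<^sup>2) * a / (ennreal (c\<^sup>2) * b) = a / b" for a b
    using c divide_mult_eq[of "ennreal (c\<^sup>2)" a b] by (simp add: mult.commute)
  then show ?thesis
    using e[OF B] e[of UNIV] B
    by (simp add: measure_def voronoi_cell_borel vimage_scaleR_borel)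
qed

text \<open>Integrating a conditional probability removes the conditioning. What remains is the
  expectation of a function of the station sequence, hence depends only on the law of that
  sequence.\<close>

lemma uplink_network_prob:
  assumes M: "prob_space M" and net: "uplink_network M \<rho> Y U" and B: "\<And>i. B i \<in> sets borel"
  shows "measure M {\<omega> \<in> space M. \<forall>i\<le>n. U i \<omega> \<in> B i} =
    (\<integral>\<omega>. (\<Prod>i\<le>n. measure (uniform_measure lborel (voronoi_cell (range (\<lambda>m. Y m \<omega>)) (Y i \<omega>))) (B i)) \<partial>M)"
proof -
  interpret prob_space M by fact
  let ?F = "vimage_algebra (space M) (stations Y) point_configs"
  let ?E = "{\<omega> \<in> space M. \<forall>i\<le>n. U i \<omega> \<in> B i}"
  have Y: "Y m \<in> borel_measurable M" and U: "U m \<in> borel_measurable M" for m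
    using net by (auto simp: uplink_network_def)
  have st: "stations Y \<in> measurable M point_configs"
    using net by (intro measurable_stations) (auto simp: uplink_network_def poisson_process_def)
  interpret finite_measure_subalgebra M ?F
    using sets_image_in_sets[OF refl st] by unfold_locales (simp add: subalgebra_def)
  have E: "?E \<in> sets M"
    unfolding Ball_def[of "{..n}", unfolded atMost_iff, symmetric]
    by (intro sets.sets_Collect_finite_All) (use U B in auto)
  have seq: "(\<lambda>\<omega> m. Y m \<omega>) \<in> measurable M (\<Pi>\<^sub>M m\<in>UNIV. borel)"
    using Y by (rule measurable_sequence)
  have h: "(\<lambda>\<omega>. \<Prod>i\<le>n. measure (uniform_measure lborel (voronoi_cell (range (\<lambda>m. Y m \<omega>)) (Y i \<omega>))) (B i)) \<in> borel_measurable M"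
    by (intro borel_measurable_prod) (rule measurable_compose[OF seq measure_voronoi_measurable[OF B]])
  have integrable: "integrable M (indicator ?E :: _ \<Rightarrow> real)"
    by (rule integrable_real_indicator[OF E]) (simp add: less_top[symmetric])
  have "measure M ?E = measure M (?E \<inter> space M)"
    by (simp only: sets.Int_space_eq2[OF E])
  also have "\<dots> = (\<integral>\<omega>. indicator ?E \<omega> \<partial>M)"
    by (rule Bochner_Integration.integral_indicator[symmetric])
  also have "\<dots> = (\<integral>\<omega>. real_cond_exp M ?F (indicator ?E) \<omega> \<partial>M)"
    by (rule real_cond_exp_int(2)[OF integrable, symmetric])
  also have "\<dots> = (\<integral>\<omega>. (\<Prod>i\<le>n. measure (uniform_measure lborel (voronoi_cell (range (\<lambda>m. Y m \<omega>)) (Y i \<omega>))) (B i)) \<partial>M)"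
  proof (rule integral_cong_AE)
    show "AE \<omega> in M. real_cond_exp M ?F (indicator ?E) \<omega> =
        (\<Prod>i\<le>n. measure (uniform_measure lborel (voronoi_cell (range (\<lambda>m. Y m \<omega>)) (Y i \<omega>))) (B i))"
      unfolding stations_def[of Y, symmetric] using net B by (simp add: uplink_network_def)
  qed (rule borel_measurable_cond_exp2, rule h)
  finally show ?thesis .
qed

text \<open>Scaling keeps the order of the norms and therefore the labels, so uniqueness of the
  unlabelled law carries over to the labelled sequence.\<close>

lemma uplink_network_stations_distr:
  assumes M: "prob_space M" and N: "prob_space N"
    and net: "uplink_network M \<rho> Y U" and net': "uplink_network N (\<rho> / c\<^sup>2) Y' U'" and c: "c > 0"
  shows "distr M (\<Pi>\<^sub>M n\<in>UNIV. borel) (\<lambda>\<omega> n. c *\<^sub>R Y n \<omega>) = distr N (\<Pi>\<^sub>M n\<in>UNIV. borel) (\<lambda>\<omega> n. Y' n \<omega>)"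
proof (rule sequence_distr_eqI[OF M])
  have Y: "(\<lambda>\<omega>. c *\<^sub>R Y n \<omega>) \<in> borel_measurable M" "Y' n \<in> borel_measurable N" for n
    using net net' by (auto simp: uplink_network_def intro!: borel_measurable_scaleR)
  then show "(\<lambda>\<omega>. c *\<^sub>R Y n \<omega>) \<in> borel_measurable M" "Y' n \<in> borel_measurable N" for n .
  have "(\<lambda>x. c *\<^sub>R x) ` (\<lambda>n. Y n \<omega>) ` {1..} = (\<lambda>n. c *\<^sub>R Y n \<omega>) ` {1..}" for \<omega> by (simp add: image_image)
  then have P: "poisson_process M (\<rho> / c\<^sup>2) (\<lambda>\<omega>. (\<lambda>n. c *\<^sub>R Y n \<omega>) ` {1..})"
    using poisson_process_scaleR[of M \<rho> "\<lambda>\<omega>. (\<lambda>n. Y n \<omega>) ` {1..}", OF _ c] net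
    by (simp add: uplink_network_def)
  have P': "poisson_process N (\<rho> / c\<^sup>2) (\<lambda>\<omega>. (\<lambda>n. Y' n \<omega>) ` {1..})"
    using net' by (simp add: uplink_network_def)
  have mono: "AE \<omega> in M. strict_mono (\<lambda>n. norm (c *\<^sub>R Y n \<omega>))"
    using net c by (simp add: uplink_network_def strict_mono_def)
  fix n and B :: "nat \<Rightarrow> plane set" assume B: "\<And>i. B i \<in> sets borel"
  have "emeasure M {\<omega> \<in> space M. \<forall>i\<in>{..n}. c *\<^sub>R Y i \<omega> \<in> B i} =
      emeasure N {\<omega> \<in> space N. \<forall>i\<in>{..n}. Y' i \<omega> \<in> B i}"
    using labelled_poisson_process_emeasure[of "\<lambda>n \<omega>. c *\<^sub>R Y n \<omega>" M "{..n}" B, OF Y(1) _ mono _ _ B]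
      labelled_poisson_process_emeasure[of Y' N "{..n}" B, OF Y(2) _ _ _ _ B]
      poisson_process_unique[OF M N P P'] net net' P P'
    by (simp add: uplink_network_def poisson_process_def)
  then show "emeasure M {\<omega> \<in> space M. \<forall>i\<le>n. c *\<^sub>R Y i \<omega> \<in> B i} = emeasure N {\<omega> \<in> space N. \<forall>i\<le>n. Y' i \<omega> \<in> B i}"
    by (simp only: Ball_def atMost_iff)
qed

text \<open>Both finite-dimensional probabilities are integrals of the same function
  \<open>?h\<close> of the stations: on the left, pulling the sets \<open>B i\<close> back by the
  scaling amounts to evaluating \<open>?h\<close> at the scaled stations, whose law agrees with that
  of \<open>Y'\<close>.\<close>

lemma uplink_network_mobiles_distr:
  assumes M: "prob_space M" and N: "prob_space N"
    and net: "uplink_network M \<rho> Y U" and net': "uplink_network N (\<rho> / c\<^sup>2) Y' U'" and c: "c > 0"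
  shows "distr M (\<Pi>\<^sub>M n\<in>UNIV. borel) (\<lambda>\<omega> n. c *\<^sub>R U n \<omega>) = distr N (\<Pi>\<^sub>M n\<in>UNIV. borel) (\<lambda>\<omega> n. U' n \<omega>)"
proof (rule sequence_distr_eqI[OF M])
  interpret M: prob_space M by fact
  interpret N: prob_space N by fact
  show "(\<lambda>\<omega>. c *\<^sub>R U n \<omega>) \<in> borel_measurable M" "U' n \<in> borel_measurable N" for n
    using net net' by (auto simp: uplink_network_def intro!: borel_measurable_scaleR)
  have Y: "(\<lambda>\<omega> n. c *\<^sub>R Y n \<omega>) \<in> measurable M (\<Pi>\<^sub>M n\<in>UNIV. borel)" "(\<lambda>\<omega> n. Y' n \<omega>) \<in> measurable N (\<Pi>\<^sub>M n\<in>UNIV. borel)"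
    using net net' by (auto simp: uplink_network_def intro!: measurable_sequence borel_measurable_scaleR)
  fix n and B :: "nat \<Rightarrow> plane set" assume B: "\<And>i. B i \<in> sets borel"
  let ?h = "\<lambda>y::nat \<Rightarrow> plane. \<Prod>i\<le>n. measure (uniform_measure lborel (voronoi_cell (range y) (y i))) (B i)"
  have h: "?h \<in> borel_measurable (\<Pi>\<^sub>M n\<in>UNIV. borel)"
    by (intro borel_measurable_prod measure_voronoi_measurable B)
  have "range (\<lambda>n. c *\<^sub>R Y n \<omega>) = (\<lambda>x. c *\<^sub>R x) ` range (\<lambda>n. Y n \<omega>)" for \<omega> by (simp add: image_image)
  then have "(\<Prod>i\<le>n. measure (uniform_measure lborel (voronoi_cell (range (\<lambda>n. Y n \<omega>)) (Y i \<omega>))) ((\<lambda>x. c *\<^sub>R x) -` B i)) =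
      ?h (\<lambda>n. c *\<^sub>R Y n \<omega>)" for \<omega>
    using measure_uniform_voronoi_scaleR[OF c B] by simp
  then have "measure M {\<omega> \<in> space M. \<forall>i\<le>n. U i \<omega> \<in> (\<lambda>x. c *\<^sub>R x) -` B i} = (\<integral>\<omega>. ?h (\<lambda>n. c *\<^sub>R Y n \<omega>) \<partial>M)"
    using uplink_network_prob[OF M net, of "\<lambda>i. (\<lambda>x. c *\<^sub>R x) -` B i" n] B by (simp only: vimage_scaleR_borel)
  also have "\<dots> = (\<integral>y. ?h y \<partial>distr M (\<Pi>\<^sub>M n\<in>UNIV. borel) (\<lambda>\<omega> n. c *\<^sub>R Y n \<omega>))"
    by (rule integral_distr[OF Y(1) h, symmetric])
  also have "\<dots> = (\<integral>y. ?h y \<partial>distr N (\<Pi>\<^sub>M n\<in>UNIV. borel) (\<lambda>\<omega> n. Y' n \<omega>))"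
    by (simp only: uplink_network_stations_distr[OF M N net net' c])
  also have "\<dots> = (\<integral>\<omega>. ?h (\<lambda>n. Y' n \<omega>) \<partial>N)"
    by (rule integral_distr[OF Y(2) h])
  also have "\<dots> = measure N {\<omega> \<in> space N. \<forall>i\<le>n. U' i \<omega> \<in> B i}"
    by (rule uplink_network_prob[OF N net' B, symmetric])
  finally show "emeasure M {\<omega> \<in> space M. \<forall>i\<le>n. c *\<^sub>R U i \<omega> \<in> B i} = emeasure N {\<omega> \<in> space N. \<forall>i\<le>n. U' i \<omega> \<in> B i}"
    by (simp add: M.emeasure_eq_measure N.emeasure_eq_measure)
qed

section \<open>The outage event\<close>

text \<open>Reconciles the two conventions for a divergent nonnegative sum, 0 among the reals and
  infinity in \<open>ennreal\<close>: a finite supremum of the partial sums would bound them and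
  force summability.\<close>

lemma infsum_ennreal_eq:
  fixes f :: "'a \<Rightarrow> real"
  assumes f: "\<And>x. x \<in> A \<Longrightarrow> 0 \<le> f x"
  shows "(\<Sum>\<^sub>\<infinity>x\<in>A. ennreal (f x)) = (if f summable_on A then ennreal (infsum f A) else top)"
proof -
  have sup: "(\<Sum>\<^sub>\<infinity>x\<in>A. ennreal (f x)) = (SUP F\<in>{F. finite F \<and> F \<subseteq> A}. ennreal (sum f F))"
    by (subst nonneg_infsum_complete) (auto intro!: SUP_cong sum_ennreal f)
  show ?thesis
  proof (cases "f summable_on A")
    case True
    then show ?thesis using infsum_nonneg_is_SUPREMUM_ennreal[OF True f] sup by simp
  next
    case False
    have "(SUP F\<in>{F. finite F \<and> F \<subseteq> A}. ennreal (sum f F)) = top"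
    proof (rule ccontr)
      assume "(SUP F\<in>{F. finite F \<and> F \<subseteq> A}. ennreal (sum f F)) \<noteq> top"
      then obtain c where c: "c \<ge> 0" "(SUP F\<in>{F. finite F \<and> F \<subseteq> A}. ennreal (sum f F)) = ennreal c"
        by (cases "SUP F\<in>{F. finite F \<and> F \<subseteq> A}. ennreal (sum f F)" rule: ennreal_cases) auto
      have "sum f F \<le> c" if "F \<subseteq> A" "finite F" for F
      proof -
        have "ennreal (sum f F) \<le> ennreal c"
          unfolding c(2)[symmetric] using that by (intro SUP_upper) auto
        then show ?thesis using c(1) by simp
      qed
      then have "f summable_on A"
        using f by (intro nonneg_bdd_above_summable_on) (auto intro!: bdd_aboveI[of _ c])
      with False show False by simp
    qed
    with sup False show ?thesis by simp
  qed
qed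

lemma le_infsum_ennreal:
  fixes f :: "'a \<Rightarrow> ennreal"
  assumes "x \<in> A" shows "f x \<le> infsum f A"
proof -
  have "sum f {x} \<le> (SUP F\<in>{F. finite F \<and> F \<subseteq> A}. sum f F)" using assms by (intro SUP_upper) auto
  then show ?thesis by (simp add: nonneg_infsum_complete)
qed

lemma cancelled_sets:
  "{u \<in> space (\<Pi>\<^sub>M n\<in>UNIV. borel). n \<in> cancelled K u} \<in> sets (\<Pi>\<^sub>M n\<in>UNIV. (borel :: plane measure))"
proof -
  have c: "(\<lambda>u. u m) \<in> measurable (\<Pi>\<^sub>M n\<in>UNIV. (borel :: plane measure)) borel" for m :: nat
    by (rule measurable_component_singleton) simp
  show ?thesis
    unfolding cancelled_def using c[measurable] by measurable
qed

text \<open>The index set of the sum depends on \<open>u\<close>. Moving the restriction into the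
  terms gives a series over all labels with measurable terms.\<close>

lemma interference_measurable:
  "interference \<alpha> K p \<in> borel_measurable (\<Pi>\<^sub>M n\<in>UNIV. borel)"
proof -
  have c: "(\<lambda>u. u m) \<in> measurable (\<Pi>\<^sub>M n\<in>UNIV. (borel :: plane measure)) borel" for m :: nat
    by (rule measurable_component_singleton) simp
  have "interference \<alpha> K p u =
      (\<Sum>n. if n \<noteq> 0 \<and> n \<notin> cancelled K u then ennreal (p * norm (u n) powr (- \<alpha>)) else 0)" for u
  proof -
    let ?f = "\<lambda>n. if n \<noteq> 0 \<and> n \<notin> cancelled K u then ennreal (p * norm (u n) powr (- \<alpha>)) else 0"
    have "?f summable_on UNIV" by (rule nonneg_summable_on_complete) simp
    then have "?f sums infsum ?f UNIV" by (intro has_sum_imp_sums has_sum_infsum)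
    moreover have "interference \<alpha> K p u = infsum ?f UNIV"
      unfolding interference_def by (rule infsum_cong_neutral) auto
    ultimately show ?thesis by (simp add: sums_iff)
  qed
  then have eq: "interference \<alpha> K p = (\<lambda>u. \<Sum>n. if n \<noteq> 0 \<and> n \<notin> cancelled K u
      then ennreal (p * norm (u n) powr (- \<alpha>)) else 0)" by (rule ext)
  have "Measurable.pred (\<Pi>\<^sub>M n\<in>UNIV. borel) (\<lambda>u. n \<in> cancelled K u)" for n
    using cancelled_sets[of n K] by (simp add: pred_def)
  note [measurable] = this c
  show ?thesis unfolding eq by measurable
qed

text \<open>The signal contributes to the single label 0, so it shifts the value of the sum without
  affecting its convergence.\<close>

lemma normalized_excess_eq:
  "normalized_excess \<alpha> \<theta> K u =
    (if (\<lambda>n. norm (u n) powr (- \<alpha>)) summable_on - ({0} \<union> cancelled K u)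
     then (\<Sum>\<^sub>\<infinity>n \<in> - ({0} \<union> cancelled K u). norm (u n) powr (- \<alpha>)) - inverse \<theta> * norm (u 0) powr (- \<alpha>)
     else 0)"
proof -
  let ?N = "- ({0} \<union> cancelled K u)" and ?g = "\<lambda>n. norm (u n) powr (- \<alpha>)"
  let ?a = "inverse \<theta> * norm (u 0) powr (- \<alpha>)"
  let ?f = "\<lambda>n. ?g n * of_bool (n \<notin> {0} \<union> cancelled K u)"
    and ?h = "\<lambda>n. inverse \<theta> * norm (u 0) powr (- \<alpha>) * of_bool (n = 0)"
  have h: "(?h has_sum ?a) UNIV"
    using has_sum_finite_neutralI[of "{0}" UNIV ?h] by auto
  have f_sum: "(?f has_sum s) UNIV \<longleftrightarrow> (?g has_sum s) ?N" for s
    by (rule has_sum_cong_neutral) auto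
  have diff: "(?f has_sum (s + ?a)) UNIV" if "((\<lambda>n. ?f n - ?h n) has_sum s) UNIV" for s
    using has_sum_add[OF that h] by simp
  show ?thesis
  proof (cases "?g summable_on ?N")
    case True
    then have "(?f has_sum infsum ?g ?N) UNIV" using f_sum has_sum_infsum by blast
    then have "((\<lambda>n. ?f n - ?h n) has_sum (infsum ?g ?N - ?a)) UNIV"
      using has_sum_add[OF _ has_sum_uminusI[OF h]] by fastforce
    then show ?thesis using True unfolding normalized_excess_def by (simp only: infsumI if_True)
  next
    case False
    then have "\<not> (\<lambda>n. ?f n - ?h n) summable_on UNIV"
      using diff f_sum unfolding summable_on_def by blast
    then show ?thesis using False unfolding normalized_excess_def by (simp only: infsum_not_exists if_False not_False_eq_True)
  qed
qed

lemma zero_less_mult_pos_iff: "0 < a \<Longrightarrow> 0 < a * b \<longleftrightarrow> 0 < b" for a b :: real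
  by (simp add: zero_less_mult_iff)

lemma ennreal_divide_add_less_iff:
  assumes "0 \<le> a" "0 \<le> b" "0 < s" "0 < t"
  shows "ennreal a / (ennreal b + ennreal s) < ennreal t \<longleftrightarrow> a < t * (b + s)"
proof -
  have "ennreal a / (ennreal b + ennreal s) = ennreal (a / (b + s))"
    using assms by (simp add: divide_ennreal add_nonneg_pos flip: ennreal_plus)
  then show ?thesis
    using assms by (simp add: ennreal_less_iff pos_divide_less_eq add_nonneg_pos)
qed

text \<open>With finite interference the ratio is cleared of its denominator and divided by
  \<open>\<theta> * p\<close>. With infinite interference both sides hold: the ratio is 0, and the
  excess has its default value 0 while \<open>s / p > 0\<close>.\<close>

lemma outage_iff_normalized_excess:
  assumes "p > 0" "s > 0" "\<theta> > 0"
  shows "ennreal (p * norm (u 0) powr (- \<alpha>)) / (interference \<alpha> K p u + ennreal s) < ennreal \<theta>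
    \<longleftrightarrow> normalized_excess \<alpha> \<theta> K u + s / p > 0"
proof -
  let ?N = "- ({0} \<union> cancelled K u)" and ?g = "\<lambda>n. norm (u n) powr (- \<alpha>)"
  have I: "interference \<alpha> K p u = (if ?g summable_on ?N then ennreal (p * infsum ?g ?N) else top)"
    unfolding interference_def using assms(1)
    by (subst infsum_ennreal_eq) (auto simp: summable_on_cmult_right' infsum_cmult_right')
  show ?thesis
  proof (cases "?g summable_on ?N")
    case True
    define \<Sigma> where "\<Sigma> = infsum ?g ?N"
    have "\<Sigma> \<ge> 0" unfolding \<Sigma>_def by (rule infsum_nonneg) simp
    have eq: "\<theta> * (p * \<Sigma> + s) - p * ?g 0 = (\<theta> * p) * (\<Sigma> - inverse \<theta> * ?g 0 + s / p)"
      using assms by (simp add: field_simps)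
    have I': "interference \<alpha> K p u = ennreal (p * \<Sigma>)"
      using I True by (simp only: \<Sigma>_def if_True)
    have "ennreal (p * ?g 0) / (ennreal (p * \<Sigma>) + ennreal s) < ennreal \<theta> \<longleftrightarrow> p * ?g 0 < \<theta> * (p * \<Sigma> + s)"
      using assms \<open>\<Sigma> \<ge> 0\<close> by (intro ennreal_divide_add_less_iff) auto
    also have "\<dots> \<longleftrightarrow> 0 < (\<theta> * p) * (\<Sigma> - inverse \<theta> * ?g 0 + s / p)"
      by (simp only: eq[symmetric] diff_gt_0_iff_gt)
    also have "\<dots> \<longleftrightarrow> 0 < \<Sigma> - inverse \<theta> * ?g 0 + s / p"
      using assms by (intro zero_less_mult_pos_iff) simp
    also have "\<Sigma> - inverse \<theta> * ?g 0 = normalized_excess \<alpha> \<theta> K u"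
      using True by (simp only: normalized_excess_eq \<Sigma>_def if_True)
    finally show ?thesis unfolding I' .
  next
    case False
    then show ?thesis using I assms by (simp add: normalized_excess_eq)
  qed
qed

text \<open>Cancellation only compares norms and so ignores scaling, while every term of the sum
  picks up the same factor.\<close>

lemma normalized_excess_scaleR:
  assumes "c > 0"
  shows "normalized_excess \<alpha> \<theta> K (\<lambda>n. c *\<^sub>R u n) = c powr (- \<alpha>) * normalized_excess \<alpha> \<theta> K u"
proof -
  have "cancelled K (\<lambda>n. c *\<^sub>R u n) = cancelled K u"
    using assms by (simp add: cancelled_def)
  moreover have "norm (c *\<^sub>R u n) powr (- \<alpha>) = c powr (- \<alpha>) * norm (u n) powr (- \<alpha>)" for n
    using assms by (simp add: powr_mult)
  ultimately show ?thesis
    unfolding normalized_excess_def infsum_cmult_right'[symmetric]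
    by (intro infsum_cong) (simp add: algebra_simps)
qed

text \<open>Read as an outage event with power 1 and noise \<open>\<mu>\<close>, the set inherits
  measurability from \<open>interference\<close>.\<close>

lemma normalized_excess_sets:
  assumes "\<mu> > 0" "\<theta> > 0"
  shows "{u \<in> space (\<Pi>\<^sub>M n\<in>UNIV. borel). normalized_excess \<alpha> \<theta> K u + \<mu> > 0} \<in> sets (\<Pi>\<^sub>M n\<in>UNIV. borel)"
proof -
  have c: "(\<lambda>u. u m) \<in> measurable (\<Pi>\<^sub>M n\<in>UNIV. (borel :: plane measure)) borel" for m :: nat
    by (rule measurable_component_singleton) simp
  have "{u \<in> space (\<Pi>\<^sub>M n\<in>UNIV. borel).
      ennreal (1 * norm (u 0) powr (- \<alpha>)) / (interference \<alpha> K 1 u + ennreal \<mu>) < ennreal \<theta>} \<in> sets (\<Pi>\<^sub>M n\<in>UNIV. borel)"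
    using c[measurable] interference_measurable[measurable] by measurable
  then show ?thesis using outage_iff_normalized_excess[of 1 \<mu> \<theta>] assms by simp
qed

lemma outage_prob_eq:
  assumes M: "prob_space M" and net: "uplink_network M \<rho> Y U" and net1: "uplink_network M 1 Y1 U1"
    and \<rho>: "\<rho> > 0" and \<mu>: "\<mu> > 0" and \<theta>: "\<theta> > 0" and \<sigma>: "\<sigma>\<^sup>2 > 0"
  shows "outage_prob M \<alpha> \<theta> \<sigma> K U (\<sigma>\<^sup>2 / (\<mu> * \<rho> powr (\<alpha> / 2))) =
    measure M {\<omega> \<in> space M. normalized_excess \<alpha> \<theta> K (\<lambda>n. U1 n \<omega>) + \<mu> > 0}"
proof -
  define c where "c = sqrt \<rho>"
  define p where "p = \<sigma>\<^sup>2 / (\<mu> * \<rho> powr (\<alpha> / 2))"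
  have c: "c > 0" "\<rho> / c\<^sup>2 = 1" using \<rho> by (simp_all add: c_def)
  have net1': "uplink_network M (\<rho> / c\<^sup>2) Y1 U1" unfolding c(2) by (rule net1)
  have p: "p > 0" using \<rho> \<mu> \<sigma> by (simp add: p_def)
  have cp: "c powr (- \<alpha>) * (\<sigma>\<^sup>2 / p) = \<mu>"
    using \<rho> \<mu> \<sigma> by (simp add: p_def c_def powr_half_sqrt[symmetric] powr_powr powr_minus)
  let ?P = "\<Pi>\<^sub>M n\<in>(UNIV::nat set). (borel :: plane measure)"
  let ?G = "{u \<in> space ?P. normalized_excess \<alpha> \<theta> K u + \<mu> > 0}"
  have G: "?G \<in> sets ?P" by (rule normalized_excess_sets[OF \<mu> \<theta>])
  have meas: "(\<lambda>\<omega> n. c *\<^sub>R U n \<omega>) \<in> measurable M ?P" "(\<lambda>\<omega> n. U1 n \<omega>) \<in> measurable M ?P"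
    using net net1 by (auto simp: uplink_network_def intro!: measurable_sequence borel_measurable_scaleR)
  have "outage_prob M \<alpha> \<theta> \<sigma> K U p =
      measure M {\<omega> \<in> space M. normalized_excess \<alpha> \<theta> K (\<lambda>n. U n \<omega>) + \<sigma>\<^sup>2 / p > 0}"
    unfolding outage_prob_def using outage_iff_normalized_excess[OF p \<sigma> \<theta>, of "\<lambda>n. U n _"] by simp
  also have "{\<omega> \<in> space M. normalized_excess \<alpha> \<theta> K (\<lambda>n. U n \<omega>) + \<sigma>\<^sup>2 / p > 0} =
      (\<lambda>\<omega> n. c *\<^sub>R U n \<omega>) -` ?G \<inter> space M"
  proof -
    \<comment> \<open>Multiplication by a positive factor keeps the sign; by \<open>cp\<close> it
      turns the noise term into \<open>\<mu>\<close>.\<close>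
    have "normalized_excess \<alpha> \<theta> K (\<lambda>n. U n \<omega>) + \<sigma>\<^sup>2 / p > 0 \<longleftrightarrow>
        c powr (- \<alpha>) * (normalized_excess \<alpha> \<theta> K (\<lambda>n. U n \<omega>) + \<sigma>\<^sup>2 / p) > 0" for \<omega>
      using c by (simp add: zero_less_mult_iff)
    also have "\<dots> \<omega> \<longleftrightarrow> normalized_excess \<alpha> \<theta> K (\<lambda>n. c *\<^sub>R U n \<omega>) + \<mu> > 0" for \<omega>
      using normalized_excess_scaleR[OF c(1), of \<alpha> \<theta> K "\<lambda>n. U n \<omega>"] cp by (simp only: distrib_left)
    finally show ?thesis using measurable_space[OF meas(1)] by auto
  qed
  also have "measure M ((\<lambda>\<omega> n. c *\<^sub>R U n \<omega>) -` ?G \<inter> space M) = measure (distr M ?P (\<lambda>\<omega> n. c *\<^sub>R U n \<omega>)) ?G"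
    by (rule measure_distr[OF meas(1) G, symmetric])
  also have "\<dots> = measure (distr M ?P (\<lambda>\<omega> n. U1 n \<omega>)) ?G"
    by (simp only: uplink_network_mobiles_distr[OF M M net net1' c(1)])
  also have "\<dots> = measure M ((\<lambda>\<omega> n. U1 n \<omega>) -` ?G \<inter> space M)"
    by (rule measure_distr[OF meas(2) G])
  also have "(\<lambda>\<omega> n. U1 n \<omega>) -` ?G \<inter> space M = {\<omega> \<in> space M. normalized_excess \<alpha> \<theta> K (\<lambda>n. U1 n \<omega>) + \<mu> > 0}"
    using measurable_space[OF meas(2)] by auto
  finally show ?thesis by (simp add: p_def)
qed

section \<open>The power received from the beacons\<close>

text \<open>One term bounds a nonnegative sum from below, and \<open>\<nu> \<le> r\<close> keeps the
  truncated distance at most \<open>r\<close>.\<close>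

lemma isotropic_power_ge:
  assumes "T \<in> S" "dist T u \<le> r" "\<nu> \<le> r" "0 < \<nu>" "0 < \<beta>" "0 \<le> q"
  shows "ennreal (q * r powr (- \<beta>)) \<le> isotropic_power \<beta> \<nu> q S u"
proof -
  have "r powr (- \<beta>) \<le> max (dist T u) \<nu> powr (- \<beta>)"
    using assms by (intro powr_mono2') auto
  then have "ennreal (r powr (- \<beta>)) \<le> ennreal (max (dist T u) \<nu> powr (- \<beta>))"
    by (rule ennreal_leI)
  also have "\<dots> \<le> (\<Sum>\<^sub>\<infinity>T\<in>S. ennreal (max (dist T u) \<nu> powr (- \<beta>)))"
    using le_infsum_ennreal[of T S "\<lambda>T. ennreal (max (dist T u) \<nu> powr (- \<beta>))"] assms(1) .
  finally show ?thesis
    unfolding isotropic_power_def using assms(6) by (simp add: ennreal_mult mult_left_mono)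
qed

text \<open>\<open>arg_min\<close> is meaningful only where a minimum is attained. Local finiteness
  ensures this: only the finitely many points in the closed ball around \<open>u\<close> through
  \<open>T\<close> compete.\<close>

lemma dist_arg_min_config_le:
  assumes S: "S \<in> space point_configs" and T: "T \<in> S"
  shows "dist (arg_min (\<lambda>T. dist T u) (\<lambda>T. T \<in> S)) u \<le> dist T u"
proof -
  let ?C = "S \<inter> cball u (dist T u)"
  have C: "finite ?C" "?C \<noteq> {}" "T \<in> ?C" using finite_config_Int[OF S] T by (auto simp: dist_commute)
  obtain x where "is_arg_min (\<lambda>T. dist T u) (\<lambda>T. T \<in> ?C) x"
    using ex_is_arg_min_if_finite[OF C(1,2)] by blast
  then have x: "x \<in> ?C" "\<And>y. y \<in> ?C \<Longrightarrow> dist x u \<le> dist y u"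
    unfolding is_arg_min_def by (meson not_less)+
  show ?thesis
  proof (rule arg_minI[of _ x])
    show "x \<in> S" using x(1) by simp
    show "\<not> dist y u < dist x u" if "y \<in> S" for y
      using x(1) x(2)[of y] that by (force simp: dist_commute)
  qed (use T in \<open>auto simp: not_less\<close>)
qed

text \<open>The main lobe serves the nearest beacon, which is at least as close as \<open>T\<close>;
  the side lobes only add to it.\<close>

lemma directed_power_ge:
  assumes S: "S \<in> space point_configs" and T: "T \<in> S" "dist T u \<le> r" and "\<nu> \<le> r" "0 < \<nu>" "0 < \<beta>" "0 \<le> zm * q"
  shows "ennreal (zm * q * r powr (- \<beta>)) \<le> directed_power \<beta> \<nu> zm zs q S u"
proof -
  let ?T = "arg_min (\<lambda>T. dist T u) (\<lambda>T. T \<in> S)"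
  have "dist u ?T \<le> r" using dist_arg_min_config_le[OF S T(1), of u] T(2) by (simp add: dist_commute)
  then have "r powr (- \<beta>) \<le> max (dist u ?T) \<nu> powr (- \<beta>)"
    using assms by (intro powr_mono2') auto
  then have "ennreal (zm * q * r powr (- \<beta>)) \<le> ennreal (zm * q * max (dist u ?T) \<nu> powr (- \<beta>))"
    using assms by (intro ennreal_leI mult_left_mono) auto
  then show ?thesis unfolding directed_power_def Let_def by (rule order_trans) simp
qed

text \<open>
  The mobile is rounded to one of countably many sites at distance less than \<open>\<eta>\<close>: the joint
  measurability of \<open>\<Psi> \<omega> \<inter> cball (V \<omega>) r = {}\<close> is thus not needed.
\<close>

lemma poisson_process_void_prob_shrunk:
  assumes M: "prob_space M" and \<Psi>: "poisson_process M \<rho> \<Psi>" and V: "V \<in> borel_measurable M"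
    and indep: "\<And>A B. A \<in> sets point_configs \<Longrightarrow> B \<in> sets borel \<Longrightarrow>
      measure M ((\<Psi> -` A \<inter> space M) \<inter> (V -` B \<inter> space M)) = measure M (\<Psi> -` A \<inter> space M) * measure M (V -` B \<inter> space M)"
    and E: "E \<subseteq> {\<omega> \<in> space M. \<Psi> \<omega> \<inter> cball (V \<omega>) r = {}}"
    and \<eta>: "0 < \<eta>" "\<eta> < r"
  shows "measure M E \<le> exp (- (\<rho> * (pi * (r - \<eta>)\<^sup>2)))"
proof -
  interpret prob_space M by fact
  have \<Psi>_meas: "\<Psi> \<in> measurable M point_configs" using \<Psi> by (simp add: poisson_process_def)
  obtain D :: "plane set" where D: "countable D" "\<And>X. open X \<Longrightarrow> X \<noteq> {} \<Longrightarrow> \<exists>d\<in>D. d \<in> X"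
    by (erule countable_dense_setE)
  have "D \<noteq> {}" using D(2)[of UNIV] by auto
  define d where "d = from_nat_into D"
  have range_d: "range d = D" unfolding d_def using D(1) \<open>D \<noteq> {}\<close> by (rule range_from_nat_into[rotated])
  \<comment> \<open>Making the balls disjoint yields a partition of the plane, so each position of
    the mobile is assigned exactly one site.\<close>
  define A where "A = disjointed (\<lambda>j. ball (d j) \<eta>)"
  have A_borel: "A j \<in> sets borel" for j
  proof -
    have "range (\<lambda>j. ball (d j) \<eta>) \<subseteq> sets borel" by auto
    then show ?thesis unfolding A_def using sets.range_disjointed_sets by blast
  qed
  have A_sub: "A j \<subseteq> ball (d j) \<eta>" for j unfolding A_def by (rule disjointed_subset)
  have A_UN: "(\<Union>j. A j) = UNIV"
  proof -
    have "x \<in> (\<Union>j. ball (d j) \<eta>)" for x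
      using D(2)[of "ball x \<eta>"] \<eta>(1) range_d by (auto simp: dist_commute)
    then show ?thesis unfolding A_def UN_disjointed_eq by blast
  qed
  have A_disj: "disjoint_family A" unfolding A_def by (rule disjoint_family_disjointed)
  define N where "N j = {S \<in> space point_configs. card (S \<inter> cball (d j) (r - \<eta>)) = 0}" for j
  have N: "N j \<in> sets point_configs" for j unfolding N_def by (rule count_sets_point_configs) auto
  define C where "C j = (\<Psi> -` N j \<inter> space M) \<inter> (V -` A j \<inter> space M)" for j
  have C: "range C \<subseteq> events"
    using measurable_sets[OF \<Psi>_meas N] measurable_sets[OF V A_borel] by (auto simp: C_def)
  have prob_N: "prob (\<Psi> -` N j \<inter> space M) = exp (- (\<rho> * (pi * (r - \<eta>)\<^sup>2)))" for j
  proof -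
    have "\<Psi> -` N j \<inter> space M = {\<omega> \<in> space M. card (\<Psi> \<omega> \<inter> cball (d j) (r - \<eta>)) = 0}"
      using measurable_space[OF \<Psi>_meas] by (auto simp: N_def)
    moreover have "measure lborel (cball (d j) (r - \<eta>)) = pi * (r - \<eta>)\<^sup>2"
      using content_cball[of "r - \<eta>" "d j"] \<eta> by (simp add: unit_ball_vol_2)
    ultimately show ?thesis using \<Psi> unfolding poisson_process_def by simp
  qed
  have "(\<lambda>j. prob (C j)) sums prob (\<Union>j. C j)"
    using C A_disj by (intro finite_measure_UNION) (auto simp: C_def disjoint_family_on_def)
  \<comment> \<open>By stationarity the void probability is the same at every site, and the
    probabilities of the cells \<open>A j\<close> sum to 1.\<close>
  moreover have "(\<lambda>j. prob (C j)) sums (exp (- (\<rho> * (pi * (r - \<eta>)\<^sup>2))) * 1)"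
  proof -
    have "(\<lambda>j. prob (V -` A j \<inter> space M)) sums prob (\<Union>j. V -` A j \<inter> space M)"
      using measurable_sets[OF V A_borel] A_disj
      by (intro finite_measure_UNION) (auto simp: disjoint_family_on_def)
    also have "(\<Union>j. V -` A j \<inter> space M) = space M" using A_UN by blast
    finally have "(\<lambda>j. prob (V -` A j \<inter> space M)) sums 1" by (simp add: prob_space)
    then show ?thesis
      unfolding C_def indep[OF N A_borel] prob_N by (rule sums_mult)
  qed
  ultimately have "prob (\<Union>j. C j) = exp (- (\<rho> * (pi * (r - \<eta>)\<^sup>2)))"
    using sums_unique2 by fastforce
  moreover have "E \<subseteq> (\<Union>j. C j)"
  proof
    fix \<omega> assume "\<omega> \<in> E"
    then have \<omega>: "\<omega> \<in> space M" and void: "\<Psi> \<omega> \<inter> cball (V \<omega>) r = {}" using E by auto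
    obtain j where j: "V \<omega> \<in> A j" using A_UN by blast
    then have dist: "dist (V \<omega>) (d j) < \<eta>" using A_sub[of j] by (auto simp: dist_commute)
    have "cball (d j) (r - \<eta>) \<subseteq> cball (V \<omega>) r"
    proof
      fix t assume "t \<in> cball (d j) (r - \<eta>)"
      then show "t \<in> cball (V \<omega>) r"
        using dist dist_triangle[of "V \<omega>" t "d j"] by (simp add: dist_commute)
    qed
    then have "\<Psi> \<omega> \<inter> cball (d j) (r - \<eta>) = {}" using void by blast
    then have "\<Psi> \<omega> \<in> N j" using measurable_space[OF \<Psi>_meas \<omega>] by (simp add: N_def)
    then have "\<omega> \<in> C j" using \<omega> j by (simp add: C_def)
    then show "\<omega> \<in> (\<Union>j. C j)" by blast
  qed
  moreover have "(\<Union>j. C j) \<in> events" using C by blast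
  ultimately show ?thesis using finite_measure_mono by metis
qed

text \<open>The rounding error \<open>\<eta>\<close> is arbitrary and the bound is continuous in it,
  so \<open>\<eta>\<close> may tend to 0.\<close>

lemma poisson_process_void_prob:
  assumes "prob_space M" and "poisson_process M \<rho> \<Psi>" and "V \<in> borel_measurable M"
    and "\<And>A B. A \<in> sets point_configs \<Longrightarrow> B \<in> sets borel \<Longrightarrow>
      measure M ((\<Psi> -` A \<inter> space M) \<inter> (V -` B \<inter> space M)) = measure M (\<Psi> -` A \<inter> space M) * measure M (V -` B \<inter> space M)"
    and "E \<subseteq> {\<omega> \<in> space M. \<Psi> \<omega> \<inter> cball (V \<omega>) r = {}}" and r: "0 < r"
  shows "measure M E \<le> exp (- (\<rho> * (pi * r\<^sup>2)))"
proof (rule tendsto_lowerbound)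
  have "((\<lambda>\<eta>. exp (- (\<rho> * (pi * (r - \<eta>)\<^sup>2)))) \<longlongrightarrow> exp (- (\<rho> * (pi * (r - 0)\<^sup>2)))) (at_right 0)"
    by (intro tendsto_intros)
  then show "((\<lambda>\<eta>. exp (- (\<rho> * (pi * (r - \<eta>)\<^sup>2)))) \<longlongrightarrow> exp (- (\<rho> * (pi * r\<^sup>2)))) (at_right 0)" by simp
  have "\<forall>\<^sub>F \<eta> in at_right 0. \<eta> \<in> {0<..<r}" using r by (rule eventually_at_right_real)
  then show "\<forall>\<^sub>F \<eta> in at_right 0. measure M E \<le> exp (- (\<rho> * (pi * (r - \<eta>)\<^sup>2)))"
  proof (rule eventually_mono)
    fix \<eta> assume "\<eta> \<in> {0<..<r}"
    then have "0 < \<eta>" "\<eta> < r" by simp_all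
    then show "measure M E \<le> exp (- (\<rho> * (pi * (r - \<eta>)\<^sup>2)))"
      by (intro poisson_process_void_prob_shrunk[where \<Psi>=\<Psi> and V=V] assms(1-5))
  qed
qed simp

section \<open>Feasibility of the hybrid network\<close>

lemma hybrid_network_mobile_measurable:
  assumes "hybrid_network M Y U \<Psi>" "\<rho> > 0" shows "U \<rho> n \<in> borel_measurable M"
  using assms by (simp add: hybrid_network_def uplink_network_def)

text \<open>The typical mobile is one measurable coordinate of the sequence of stations and mobiles,
  whose algebra is assumed independent of the beacons.\<close>

lemma hybrid_network_indep:
  assumes net: "hybrid_network M Y U \<Psi>" and \<rho>: "\<rho>\<^sub>b > 0" "\<rho>\<^sub>p > 0"
    and A: "A \<in> sets point_configs" and B: "B \<in> sets borel"
  shows "measure M ((\<Psi> \<rho>\<^sub>p -` A \<inter> space M) \<inter> (U \<rho>\<^sub>b 0 -` B \<inter> space M)) =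
    measure M (\<Psi> \<rho>\<^sub>p -` A \<inter> space M) * measure M (U \<rho>\<^sub>b 0 -` B \<inter> space M)"
proof -
  have "prob_space M" using net by (simp add: hybrid_network_def)
  let ?P = "\<Pi>\<^sub>M n\<in>(UNIV :: nat set). (borel \<Otimes>\<^sub>M borel :: (plane \<times> plane) measure)"
  let ?f = "\<lambda>\<omega> n. (Y \<rho>\<^sub>b n \<omega>, U \<rho>\<^sub>b n \<omega>)"
  have "(\<lambda>f. snd (f 0)) \<in> measurable ?P borel"
    by (rule measurable_compose[OF measurable_component_singleton[of 0 UNIV "\<lambda>_. borel \<Otimes>\<^sub>M borel"] measurable_snd]) simp
  then have "(\<lambda>f. snd (f 0)) -` B \<inter> space ?P \<in> sets ?P" using B by (rule measurable_sets)
  then have "?f -` ((\<lambda>f. snd (f 0)) -` B \<inter> space ?P) \<inter> space M \<in> sets (vimage_algebra (space M) ?f ?P)"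
    by (rule in_vimage_algebra)
  moreover have "?f -` ((\<lambda>f. snd (f 0)) -` B \<inter> space ?P) \<inter> space M = U \<rho>\<^sub>b 0 -` B \<inter> space M"
    by (auto simp: space_PiM space_pair_measure)
  ultimately have "U \<rho>\<^sub>b 0 -` B \<inter> space M \<in> sets (vimage_algebra (space M) ?f ?P)" by (simp only:)
  moreover have "\<Psi> \<rho>\<^sub>p -` A \<inter> space M \<in> sets (vimage_algebra (space M) (\<Psi> \<rho>\<^sub>p) point_configs)"
    using A by (rule in_vimage_algebra)
  moreover have "prob_space.indep_set M (sets (vimage_algebra (space M) (\<Psi> \<rho>\<^sub>p) point_configs))
      (sets (vimage_algebra (space M) ?f ?P))"
    using net \<rho> by (simp add: hybrid_network_def)
  ultimately show ?thesis using prob_space.indep_setD[OF \<open>prob_space M\<close>] by blast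
qed

text \<open>
  A beacon within distance \<open>r = (Q / p) powr (1 / \<beta>)\<close> of the mobile delivers at least \<open>p\<close>; the
  two inequalities on the densities say that \<open>\<nu> \<le> r\<close> and that such a beacon is missing with
  probability at most \<open>\<delta>\<close>.
\<close>

lemma feasibility_regionI:
  assumes net: "hybrid_network M Y U \<Psi>"
    and "\<alpha> > 2" and "\<beta> > 2" and "\<nu> > 1" and "\<theta> > 0" and "\<sigma>\<^sup>2 > 0" and "0 < \<delta>" and "\<delta> < 1" and "\<mu> > 0"
    and mu: "measure M {\<omega> \<in> space M. normalized_excess \<alpha> \<theta> K (\<lambda>n. U 1 n \<omega>) + \<mu> > 0} = \<epsilon>"
    and q: "0 \<le> q" and Q: "0 \<le> Q" and "0 \<le> \<rho>\<^sub>b" "0 \<le> \<rho>\<^sub>p"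
    and density: "Q powr (2 / \<beta>) * \<rho>\<^sub>p * \<rho>\<^sub>b powr (\<alpha> / \<beta>) \<ge> ln (1 / \<delta>) / pi * (\<sigma>\<^sup>2 / \<mu>) powr (2 / \<beta>)"
    and near: "Q powr (2 / \<alpha>) * \<rho>\<^sub>b \<ge> (\<sigma>\<^sup>2 * \<nu> powr \<beta> / \<mu>) powr (2 / \<alpha>)"
    and pow: "\<And>S u T r. S \<in> space point_configs \<Longrightarrow> T \<in> S \<Longrightarrow> dist T u \<le> r \<Longrightarrow> \<nu> \<le> r \<Longrightarrow>
      ennreal (Q * r powr (- \<beta>)) \<le> pow q S u"
  shows "(q, \<rho>\<^sub>b, \<rho>\<^sub>p) \<in> feasibility_region M U \<Psi> pow \<alpha> \<theta> \<sigma> K \<epsilon> \<delta>"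
proof -
  have M: "prob_space M" using net by (simp add: hybrid_network_def)
  interpret prob_space M by fact
  \<comment> \<open>As \<open>\<delta> < 1\<close>, this bound is strictly positive. It excludes the
    triples with a zero density or zero power, for which the feasibility region or the radius
    \<open>r\<close> would make no sense.\<close>
  have "ln (1 / \<delta>) / pi * (\<sigma>\<^sup>2 / \<mu>) powr (2 / \<beta>) > 0"
    using assms by (intro mult_pos_pos divide_pos_pos) (auto simp: ln_gt_zero)
  then have "Q powr (2 / \<beta>) * \<rho>\<^sub>p * \<rho>\<^sub>b powr (\<alpha> / \<beta>) > 0" using density by linarith
  then have "Q \<noteq> 0" "\<rho>\<^sub>p \<noteq> 0" "\<rho>\<^sub>b \<noteq> 0" by auto
  then have Q0: "Q > 0" and \<rho>p: "\<rho>\<^sub>p > 0" and \<rho>b: "\<rho>\<^sub>b > 0" using assms by auto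
  define p where "p = \<sigma>\<^sup>2 / (\<mu> * \<rho>\<^sub>b powr (\<alpha> / 2))"
  have p: "p > 0" using \<rho>b assms by (simp add: p_def)
  define r where "r = (Q / p) powr (1 / \<beta>)"
  have r: "r > 0" using Q0 p by (simp add: r_def)
  have Qr: "Q * r powr (- \<beta>) = p"
    using Q0 p assms by (simp add: r_def powr_powr powr_minus)
  \<comment> \<open>Since \<open>Q / p = Q * \<mu> * \<rho>\<^sub>b powr (\<alpha> / 2) /
    \<sigma>\<^sup>2\<close>, raising the second inequality to the power \<open>\<alpha> / 2\<close>
    gives \<open>\<nu> powr \<beta> \<le> Q / p\<close>.\<close>
  have "\<nu> \<le> r"
  proof -
    have "((\<sigma>\<^sup>2 * \<nu> powr \<beta> / \<mu>) powr (2 / \<alpha>)) powr (\<alpha> / 2) \<le> (Q powr (2 / \<alpha>) * \<rho>\<^sub>b) powr (\<alpha> / 2)"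
      using near assms by (intro powr_mono2) auto
    then have "\<sigma>\<^sup>2 * \<nu> powr \<beta> / \<mu> \<le> Q * \<rho>\<^sub>b powr (\<alpha> / 2)"
      using assms Q0 \<rho>b by (simp add: powr_powr powr_mult)
    then have "\<nu> powr \<beta> \<le> Q / p"
      using assms \<rho>b by (simp add: p_def field_simps)
    then have "(\<nu> powr \<beta>) powr (1 / \<beta>) \<le> r"
      unfolding r_def using assms by (intro powr_mono2) auto
    then show ?thesis using assms by (simp add: powr_powr)
  qed
  \<comment> \<open>The exponents of the first inequality come from the area of the disc:
    \<open>r\<^sup>2 = (Q / p) powr (2 / \<beta>)\<close>, and the factor
    \<open>\<rho>\<^sub>b powr (\<alpha> / 2)\<close> hidden in \<open>1 / p\<close> becomes
    \<open>\<rho>\<^sub>b powr (\<alpha> / \<beta>)\<close>.\<close>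
  have void: "exp (- (\<rho>\<^sub>p * (pi * r\<^sup>2))) \<le> \<delta>"
  proof -
    have "r\<^sup>2 = (Q / p) powr (2 / \<beta>)"
      using r by (simp add: r_def powr_powr flip: powr_numeral)
    also have "Q / p = Q * \<rho>\<^sub>b powr (\<alpha> / 2) / (\<sigma>\<^sup>2 / \<mu>)" by (simp add: p_def)
    also have "(Q * \<rho>\<^sub>b powr (\<alpha> / 2) / (\<sigma>\<^sup>2 / \<mu>)) powr (2 / \<beta>) =
        Q powr (2 / \<beta>) * \<rho>\<^sub>b powr (\<alpha> / \<beta>) / (\<sigma>\<^sup>2 / \<mu>) powr (2 / \<beta>)"
      using assms Q0 \<rho>b by (simp add: powr_mult powr_divide powr_powr)
    finally have r2: "r\<^sup>2 = Q powr (2 / \<beta>) * \<rho>\<^sub>b powr (\<alpha> / \<beta>) / (\<sigma>\<^sup>2 / \<mu>) powr (2 / \<beta>)" .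
    define s where "s = (\<sigma>\<^sup>2 / \<mu>) powr (2 / \<beta>)"
    have s: "s > 0" using assms by (simp add: s_def)
    have "ln (1 / \<delta>) / pi \<le> \<rho>\<^sub>p * r\<^sup>2"
      using density s unfolding r2 s_def[symmetric] by (simp add: pos_le_divide_eq mult_ac)
    then have "ln (1 / \<delta>) \<le> \<rho>\<^sub>p * (pi * r\<^sup>2)"
      by (simp add: pos_divide_le_eq mult_ac)
    then have "- (\<rho>\<^sub>p * (pi * r\<^sup>2)) \<le> ln \<delta>" using assms by (simp add: ln_div)
    then have "exp (- (\<rho>\<^sub>p * (pi * r\<^sup>2))) \<le> exp (ln \<delta>)" by (simp only: exp_le_cancel_iff)
    then show ?thesis using assms by simp
  qed
  have "outage_prob M \<alpha> \<theta> \<sigma> K (U \<rho>\<^sub>b) p = \<epsilon>"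
    unfolding p_def mu[symmetric]
    using net \<rho>b assms by (intro outage_prob_eq[where Y="Y \<rho>\<^sub>b" and ?Y1.0="Y 1"]) (auto simp: hybrid_network_def)
  moreover have "power_outage_prob M pow q (\<Psi> \<rho>\<^sub>p) (U \<rho>\<^sub>b 0) p \<le> \<delta>"
  proof -
    have P: "poisson_process M \<rho>\<^sub>p (\<Psi> \<rho>\<^sub>p)" using net \<rho>p by (simp add: hybrid_network_def)
    then have \<Psi>: "\<Psi> \<rho>\<^sub>p \<omega> \<in> space point_configs" if "\<omega> \<in> space M" for \<omega>
      using that unfolding poisson_process_def by (auto dest: measurable_space)
    have sub: "{\<omega> \<in> space M. pow q (\<Psi> \<rho>\<^sub>p \<omega>) (U \<rho>\<^sub>b 0 \<omega>) < ennreal p} \<subseteq>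
        {\<omega> \<in> space M. \<Psi> \<rho>\<^sub>p \<omega> \<inter> cball (U \<rho>\<^sub>b 0 \<omega>) r = {}}"
    proof clarify
      fix \<omega> assume \<omega>: "\<omega> \<in> space M" "pow q (\<Psi> \<rho>\<^sub>p \<omega>) (U \<rho>\<^sub>b 0 \<omega>) < ennreal p"
      have "dist T (U \<rho>\<^sub>b 0 \<omega>) > r" if "T \<in> \<Psi> \<rho>\<^sub>p \<omega>" for T
        using pow[OF \<Psi>[OF \<omega>(1)] that _ \<open>\<nu> \<le> r\<close>, of "U \<rho>\<^sub>b 0 \<omega>"] \<omega>(2) unfolding Qr by (meson not_less)
      then show "\<Psi> \<rho>\<^sub>p \<omega> \<inter> cball (U \<rho>\<^sub>b 0 \<omega>) r = {}" by (force simp: dist_commute)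
    qed
    have "power_outage_prob M pow q (\<Psi> \<rho>\<^sub>p) (U \<rho>\<^sub>b 0) p \<le> exp (- (\<rho>\<^sub>p * (pi * r\<^sup>2)))"
      unfolding power_outage_prob_def
      by (rule poisson_process_void_prob[OF M P hybrid_network_mobile_measurable[OF net \<rho>b] _ sub r])
        (rule hybrid_network_indep[OF net \<rho>b \<rho>p])
    then show ?thesis using void by linarith
  qed
  ultimately show ?thesis
    using q \<rho>b \<rho>p p by (auto simp: feasibility_region_def)
qed



text \<open>Both inclusions are instances of \<open>feasibility_regionI\<close>, which sees a
  transfer scheme only through a lower bound for the power delivered when some beacon is in
  reach.\<close>

theorem proposition5:
  fixes M :: "'w measure"
    and Y U :: "real \<Rightarrow> nat \<Rightarrow> 'w \<Rightarrow> plane"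
    and \<Psi> :: "real \<Rightarrow> 'w \<Rightarrow> plane set"
    and \<alpha> \<beta> \<nu> \<theta> \<sigma> \<epsilon> \<delta> z\<^sub>m z\<^sub>s \<mu> :: real
    and K :: nat
  assumes network: "hybrid_network M Y U \<Psi>"
    and "\<alpha> > 2" and "\<beta> > 2" and "\<nu> > 1" and "\<theta> > 0" and "\<sigma>\<^sup>2 > 0"
    and "0 < \<epsilon>" and "\<epsilon> < 1" and "0 < \<delta>" and "\<delta> < 1" and "z\<^sub>m > 0" and "z\<^sub>s > 0"
    and "\<mu> > 0"
    and mu: "measure M {\<omega> \<in> space M. normalized_excess \<alpha> \<theta> K (\<lambda>n. U 1 n \<omega>) + \<mu> > 0} = \<epsilon>"
  shows "{(q, \<rho>\<^sub>b, \<rho>\<^sub>p). 0 \<le> q \<and> 0 \<le> \<rho>\<^sub>b \<and> 0 \<le> \<rho>\<^sub>p \<and>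
            q powr (2 / \<beta>) * \<rho>\<^sub>p * \<rho>\<^sub>b powr (\<alpha> / \<beta>) \<ge> ln (1 / \<delta>) / pi * (\<sigma>\<^sup>2 / \<mu>) powr (2 / \<beta>) \<and>
            q powr (2 / \<alpha>) * \<rho>\<^sub>b \<ge> (\<sigma>\<^sup>2 * \<nu> powr \<beta> / \<mu>) powr (2 / \<alpha>)}
         \<subseteq> feasibility_region M U \<Psi> (isotropic_power \<beta> \<nu>) \<alpha> \<theta> \<sigma> K \<epsilon> \<delta>
       \<and> {(q, \<rho>\<^sub>b, \<rho>\<^sub>p). 0 \<le> q \<and> 0 \<le> \<rho>\<^sub>b \<and> 0 \<le> \<rho>\<^sub>p \<and>
            (z\<^sub>m * q) powr (2 / \<beta>) * \<rho>\<^sub>p * \<rho>\<^sub>b powr (\<alpha> / \<beta>) \<ge> ln (1 / \<delta>) / pi * (\<sigma>\<^sup>2 / \<mu>) powr (2 / \<beta>) \<and>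
            (z\<^sub>m * q) powr (2 / \<alpha>) * \<rho>\<^sub>b \<ge> (\<sigma>\<^sup>2 * \<nu> powr \<beta> / \<mu>) powr (2 / \<alpha>)}
         \<subseteq> feasibility_region M U \<Psi> (directed_power \<beta> \<nu> z\<^sub>m z\<^sub>s) \<alpha> \<theta> \<sigma> K \<epsilon> \<delta>"
proof (intro conjI subsetI; clarify)
  fix q \<rho>\<^sub>b \<rho>\<^sub>p :: real
  assume *: "0 \<le> q" "0 \<le> \<rho>\<^sub>b" "0 \<le> \<rho>\<^sub>p"
    "ln (1 / \<delta>) / pi * (\<sigma>\<^sup>2 / \<mu>) powr (2 / \<beta>) \<le> q powr (2 / \<beta>) * \<rho>\<^sub>p * \<rho>\<^sub>b powr (\<alpha> / \<beta>)"
    "(\<sigma>\<^sup>2 * \<nu> powr \<beta> / \<mu>) powr (2 / \<alpha>) \<le> q powr (2 / \<alpha>) * \<rho>\<^sub>b"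
  have "ennreal (q * r powr (- \<beta>)) \<le> isotropic_power \<beta> \<nu> q S u"
    if "T \<in> S" "dist T u \<le> r" "\<nu> \<le> r" for S u T r
    using that assms * by (intro isotropic_power_ge[of T]) auto
  then show "(q, \<rho>\<^sub>b, \<rho>\<^sub>p) \<in> feasibility_region M U \<Psi> (isotropic_power \<beta> \<nu>) \<alpha> \<theta> \<sigma> K \<epsilon> \<delta>"
    by (rule feasibility_regionI[OF network assms(2-6,9,10,13) mu *(1) *(1-5)])
next
  fix q \<rho>\<^sub>b \<rho>\<^sub>p :: real
  assume *: "0 \<le> q" "0 \<le> \<rho>\<^sub>b" "0 \<le> \<rho>\<^sub>p"
    "ln (1 / \<delta>) / pi * (\<sigma>\<^sup>2 / \<mu>) powr (2 / \<beta>) \<le> (z\<^sub>m * q) powr (2 / \<beta>) * \<rho>\<^sub>p * \<rho>\<^sub>b powr (\<alpha> / \<beta>)"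
    "(\<sigma>\<^sup>2 * \<nu> powr \<beta> / \<mu>) powr (2 / \<alpha>) \<le> (z\<^sub>m * q) powr (2 / \<alpha>) * \<rho>\<^sub>b"
  \<comment> \<open>The effective power \<open>Q\<close> of the nearest beacon is now that of the
    main lobe, whereas the transmitted power is still \<open>q\<close>; in the isotropic case the
    two coincide.\<close>
  have Q: "0 \<le> z\<^sub>m * q" using * assms by simp
  have "ennreal (z\<^sub>m * q * r powr (- \<beta>)) \<le> directed_power \<beta> \<nu> z\<^sub>m z\<^sub>s q S u"
    if "S \<in> space point_configs" "T \<in> S" "dist T u \<le> r" "\<nu> \<le> r" for S u T r
    using that assms Q by (intro directed_power_ge[of S T]) auto
  then show "(q, \<rho>\<^sub>b, \<rho>\<^sub>p) \<in> feasibility_region M U \<Psi> (directed_power \<beta> \<nu> z\<^sub>m z\<^sub>s) \<alpha> \<theta> \<sigma> K \<epsilon> \<delta>"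
    by (rule feasibility_regionI[OF network assms(2-6,9,10,13) mu *(1) Q *(2-5)])
qed

end
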